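(* For positive integers $a$ and $c$, set $$g^{a}_c(x,y,z)=a t_x+c(y^2+yz+z^2),\qquad x\in\mathbb{N}_0,\ y,z\in\mathbb{Z}.$$ (1) The form $g^a_c$ represents all $n\in\mathbb{N}_0$ if and only if $(a,c)=(1,1)$. (2) If the form $g^a_c$ represents $n=1,2,4,8$ (each of these four numbers), then it represents all $n\in\mathbb{N}_0$.
   Context: $\mathbb{N}_0=\{0,1,2,\ldots\}$. For $x\in\mathbb{N}_0$, $t_x=x(x+1)/2$ denotes the $x$-th triangular number. The form $g^a_c$ represents $n$ if $n=g^a_c(x,y,z)$ for some $x\in\mathbb{N}_0$ and $y,z\in\mathbb{Z}$. *)

theory Defs
  imports Main "HOL-Library.Nat_Bijection"
begin

(* The library function triangle on nat is the triangular number: triangle x = x * (x + 1) div 2. *)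
definition g_form :: "int \<Rightarrow> int \<Rightarrow> nat \<Rightarrow> int \<Rightarrow> int \<Rightarrow> int" where
  "g_form a c x y z = a * int (triangle x) + c * (y\<^sup>2 + y * z + z\<^sup>2)"

definition form_represents :: "(nat \<Rightarrow> int \<Rightarrow> int \<Rightarrow> int) \<Rightarrow> nat \<Rightarrow> bool" where
  "form_represents g n \<longleftrightarrow> (\<exists>(x::nat) (y::int) (z::int). int n = g x y z)"

end

theory Submission
  imports Defs "HOL-Computational_Algebra.Formal_Power_Series"
begin

text \<open>
  Everything rests on Gauss' theorem that \<open>3 * m\<close> is a sum of three triangular numbers, i.e.
  \<open>24 * m + 3 = X\<^sup>2 + Y\<^sup>2 + Z\<^sup>2\<close> with \<open>X, Y, Z\<close> odd. Choosing signs such that \<open>X, Y, Z\<close> are congruent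
  modulo 3 and writing \<open>X = Y + 6 * p\<close>, \<open>Z = Y - 6 * q\<close>, one finds
  \<open>8 * m + 1 = s\<^sup>2 + 8 * (p\<^sup>2 + p * q + q\<^sup>2)\<close> with \<open>s = Y + 2 * p - 2 * q\<close> odd, so \<open>m\<close> is represented
  by \<open>g\<close> for \<open>(a, c) = (1, 1)\<close>. The values 1, 2, 4 and 8 exclude all other pairs.

  Gauss' theorem is proved without Dirichlet's theorem, by counting. Let \<open>\<psi> = (\<Sum>x. q ^ triangle x)\<close>.
  Two convolution identities of Liouville type give the logarithmic derivative of \<open>\<psi>\<close> and show
  that \<open>\<psi> ^ 4\<close> has the coefficients \<open>\<sigma>(2 * n + 1)\<close>. The number of integer matrices with rows
  \<open>(d, q)\<close>, \<open>(t, h)\<close>, determinant \<open>P = 2 * n + 1\<close>, fixed parities and "reduced" symmetric part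
  (\<open>0 < q + t < 2 * min d h\<close>) is also \<open>\<sigma>(P)\<close>; splitting off the antisymmetric part \<open>t - q\<close>
  shows that \<open>\<psi>\<close> times the series counting reduced forms of discriminant \<open>- (8 * n + 3)\<close> equals
  \<open>\<psi> ^ 4\<close>. Hence the coefficients of \<open>\<psi> ^ 3\<close> count reduced forms, and such forms always exist.
\<close>

section \<open>The logarithmic derivative of the triangular number series\<close>

text \<open>With \<open>\<psi>\<close> for \<open>triangle_series\<close>, these are the
  coefficients of \<open>q * \<psi>' / \<psi>\<close>; see
  \<open>fps_X_deriv_triangle_series\<close>.\<close>

definition alt_divisor_sum :: "nat \<Rightarrow> int" where
  "alt_divisor_sum n = (\<Sum>d | d \<in> {1..n} \<and> d dvd n. if odd d then int d else - int d)"

definition triangle_series :: "int fps" where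
  "triangle_series = Abs_fps (\<lambda>n. if n \<in> range triangle then 1 else 0)"

definition indef_forms :: "int \<Rightarrow> (int \<times> int \<times> int) set" where
  "indef_forms D = {(a, b, c). a > 0 \<and> c > 0 \<and> odd b \<and> b\<^sup>2 + 4 * a * c = D}"

lemma finite_indef_forms: "finite (indef_forms D)"
proof (rule finite_subset)
  show "indef_forms D \<subseteq> {1..D} \<times> {-D..D} \<times> {1..D}"
  proof
    fix z assume "z \<in> indef_forms D"
    then obtain a b c where z: "z = (a, b, c)" and *: "a > 0" "c > 0" "b\<^sup>2 + 4 * (a * c) = D" by (auto simp: indef_forms_def)
    have "a * c \<ge> a * 1" "a * c \<ge> 1 * c" using * by (intro mult_left_mono mult_right_mono; simp)+
    then have "a * c \<ge> a" "a * c \<ge> c" by simp_all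
    moreover have "\<bar>b\<bar> \<le> b\<^sup>2" using self_le_power[of "\<bar>b\<bar>" 2] by (cases "b = 0") auto
    moreover have "b\<^sup>2 \<ge> 0" by simp
    ultimately show "z \<in> {1..D} \<times> {-D..D} \<times> {1..D}"
      using * unfolding z mem_Times_iff atLeastAtMost_iff fst_conv snd_conv by linarith
  qed
qed simp

lemma sum_split3:
  fixes f :: "'a \<Rightarrow> int"
  assumes "finite A"
  shows "sum f A = sum f {x\<in>A. h x > 0} + sum f {x\<in>A. h x < 0} + sum f {x\<in>A. h x = (0::int)}"
proof -
  have "A = {x\<in>A. h x > 0} \<union> ({x\<in>A. h x < 0} \<union> {x\<in>A. h x = 0})" by auto
  then have "sum f A = sum f ({x\<in>A. h x > 0} \<union> ({x\<in>A. h x < 0} \<union> {x\<in>A. h x = 0}))" by simp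
  also have "\<dots> = sum f {x\<in>A. h x > 0} + sum f ({x\<in>A. h x < 0} \<union> {x\<in>A. h x = 0})"
    using assms by (subst sum.union_disjoint) auto
  also have "sum f ({x\<in>A. h x < 0} \<union> {x\<in>A. h x = 0}) = sum f {x\<in>A. h x < 0} + sum f {x\<in>A. h x = 0}"
    using assms by (subst sum.union_disjoint) auto
  finally show ?thesis by simp
qed

text \<open>
  The unipotent substitutions \<open>x \<mapsto> x + y\<close> and \<open>y \<mapsto> y + x\<close> permute the indefinite forms
  \<open>a x\<^sup>2 + b x y - c y\<^sup>2\<close> according to the sign of \<open>a + b - c\<close>, and exchange the parity classes.
\<close>

lemma indef_forms_sum:
  fixes D :: int
  defines "X \<equiv> {(a, b, c) \<in> indef_forms D. odd a \<and> even c}"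
    and "Y \<equiv> {(a, b, c) \<in> indef_forms D. even a \<and> even c}"
  shows "(\<Sum>(a, b, c)\<in>X. a) - (\<Sum>(a, b, c)\<in>Y. a) = (\<Sum>(a, b, c) | (a, b, c) \<in> X \<and> a + b = c. c)"
proof -
  define h where "h = (\<lambda>(a, b, c). a + b - c :: int)"
  define Xp Xm X0 Yp Ym Y0 where sets: "Xp = {x\<in>X. h x > 0}" "Xm = {x\<in>X. h x < 0}" "X0 = {x\<in>X. h x = 0}"
    "Yp = {x\<in>Y. h x > 0}" "Ym = {x\<in>Y. h x < 0}" "Y0 = {x\<in>Y. h x = 0}"
  have fin: "finite X" "finite Y"
    unfolding X_def Y_def by (rule finite_subset[OF _ finite_indef_forms[of D]]; auto)+
  have split: "sum f X = sum f Xp + sum f Xm + sum f X0" "sum f Y = sum f Yp + sum f Ym + sum f Y0"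
    for f :: "_ \<Rightarrow> int"
    unfolding sets by (rule sum_split3; fact)+
  \<comment> \<open>Changing the sign of \<open>b\<close> preserves \<open>X\<close>, so
    \<open>b\<close> sums to zero over \<open>X\<close>. This relation closes the linear system
    solved at the end.\<close>
  have mirror: "(\<Sum>(a, b, c)\<in>X. b) = - (\<Sum>(a, b, c)\<in>X. b)"
    unfolding sum_negf[symmetric]
    by (rule sum.reindex_bij_witness[of _ "\<lambda>(a,b,c). (a,-b,c)" "\<lambda>(a,b,c). (a,-b,c)"])
       (auto simp: X_def indef_forms_def)
  \<comment> \<open>\<open>\<phi>\<close> preserves \<open>b^2 + 4 * a * c\<close> and satisfies
    \<open>h (\<phi> (a, b, c)) = a\<close>, so it is an involution. As \<open>b\<close> is odd and
    \<open>c\<close> even, \<open>a + b - c\<close> and \<open>a\<close> differ in parity; hence it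
    exchanges \<open>Xp\<close> and \<open>Yp\<close>.\<close>
  define \<phi> where "\<phi> = (\<lambda>(a, b, c). (a + b - c, 2 * c - b, c) :: int \<times> int \<times> int)"
  have XY: "(\<Sum>x\<in>Xp. f (\<phi> x)) = sum f Yp" for f :: "_ \<Rightarrow> int"
    by (rule sum.reindex_bij_witness[of _ \<phi> \<phi>])
       (auto simp: sets X_def Y_def h_def \<phi>_def indef_forms_def power2_eq_square algebra_simps)
  have YX: "(\<Sum>x\<in>Yp. f (\<phi> x)) = sum f Xp" for f :: "_ \<Rightarrow> int"
    by (rule sum.reindex_bij_witness[of _ \<phi> \<phi>])
       (auto simp: sets X_def Y_def h_def \<phi>_def indef_forms_def power2_eq_square algebra_simps)
  have Xm: "(\<Sum>(a, b, c)\<in>Xm. b) = (\<Sum>(a, b, c)\<in>Xm. - b - 2 * a)"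
    by (rule sum.reindex_bij_witness[of _ "\<lambda>(a,b,c). (a, - b - 2 * a, c - a - b)"
          "\<lambda>(a,b,c). (a, - b - 2 * a, c - a - b)"])
       (auto simp: sets X_def Y_def h_def indef_forms_def power2_eq_square algebra_simps)
  have Ym: "(\<Sum>(a, b, c)\<in>Ym. a) = (\<Sum>(a, b, c)\<in>Yp. c)"
    by (rule sum.reindex_bij_witness[of _ "\<lambda>(a,b,c). (c, - b, a)" "\<lambda>(a,b,c). (c, - b, a)"])
       (auto simp: sets X_def Y_def h_def indef_forms_def)
  have Y0: "Y0 = {}"
    by (auto simp: sets X_def Y_def h_def indef_forms_def)
  have 1: "(\<Sum>(a, b, c)\<in>Xp. c) = (\<Sum>(a, b, c)\<in>Yp. c)"
    using XY[of "\<lambda>(a,b,c). c"] by (simp add: \<phi>_def case_prod_unfold)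
  have 2: "(\<Sum>(a, b, c)\<in>Xp. a) = (\<Sum>(a, b, c)\<in>Yp. a) + (\<Sum>(a, b, c)\<in>Yp. b) - (\<Sum>(a, b, c)\<in>Yp. c)"
    using YX[of "\<lambda>(a,b,c). a"] by (simp add: \<phi>_def case_prod_unfold sum.distrib sum_subtractf)
  have 3: "(\<Sum>(a, b, c)\<in>Yp. a) = (\<Sum>(a, b, c)\<in>Xp. a) + (\<Sum>(a, b, c)\<in>Xp. b) - (\<Sum>(a, b, c)\<in>Xp. c)"
    using XY[of "\<lambda>(a,b,c). a"] by (simp add: \<phi>_def case_prod_unfold sum.distrib sum_subtractf)
  have 4: "(\<Sum>(a, b, c)\<in>Xm. b) = - (\<Sum>(a, b, c)\<in>Xm. b) - 2 * (\<Sum>(a, b, c)\<in>Xm. a)"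
    using Xm by (simp add: case_prod_unfold sum_subtractf sum_negf sum_distrib_left)
  have 5: "(\<Sum>(a, b, c)\<in>X0. a) + (\<Sum>(a, b, c)\<in>X0. b) = (\<Sum>(a, b, c)\<in>X0. c)"
    unfolding sum.distrib[symmetric] by (rule sum.cong) (auto simp: sets h_def)
  have 6: "X0 = {(a, b, c). (a, b, c) \<in> X \<and> a + b = c}"
    by (auto simp: sets h_def)
  \<comment> \<open>By \<open>1\<close>, \<open>3\<close> and \<open>Ym\<close>, the left side is
    the sum of \<open>a\<close> over \<open>Xm\<close> and \<open>X0\<close> minus the sum of
    \<open>b\<close> over \<open>Xp\<close>. Then \<open>4\<close> and \<open>mirror\<close> turn it
    into the sum of \<open>a + b\<close> over \<open>X0\<close>.\<close>
  show ?thesis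
    using 1 2 3 4 5 mirror Ym unfolding 6[symmetric] split Y0 by simp
qed

section \<open>Triangular numbers and their convolution with the alternating divisor sum\<close>

lemma inj_triangle: "inj triangle"
  by (rule strict_mono_imp_inj_on) (simp add: strict_mono_Suc_iff)

lemma eight_triangle: "8 * int (triangle x) + 1 = (2 * int x + 1)\<^sup>2"
  by (induction x) (simp_all add: power2_eq_square algebra_simps)

lemma le_triangle: "x \<le> triangle x"
  by (induction x) auto

lemma finite_triangle_le: "finite {x. triangle x \<le> n}"
  by (rule finite_subset[of _ "{..n}"]) (auto intro: order_trans[OF le_triangle])

text \<open>A solution of \<open>triangle x + d * e = n\<close> amounts to the form
  \<open>(d, 2 * x + 1, 2 * e)\<close> of discriminant \<open>8 * n + 1\<close>. Both signs of
  \<open>b\<close> occur, so \<open>indef_forms_sum\<close> evaluates twice the convolution. Only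
  forms with \<open>a + b = c\<close> survive; their discriminant is \<open>(a + c)^2\<close>, which
  forces \<open>n\<close> to be triangular.\<close>

lemma alt_divisor_sum_convolution:
  "(\<Sum>x | triangle x \<le> n. alt_divisor_sum (n - triangle x)) =
     (if n \<in> range triangle then int n else 0)"
proof -
  define D where "D = 8 * int n + 1"
  define X Y where "X = {(a, b, c) \<in> indef_forms D. odd a \<and> even c}"
    and "Y = {(a, b, c) \<in> indef_forms D. even a \<and> even c}"
  define f where "f = (\<lambda>(a, b::int, c::int). if odd a then a else - a :: int)"
  define T where "T = {(x, d, e). d > 0 \<and> e > 0 \<and> triangle x + d * e = n}"
  define Z where "Z = {(a, b, c) \<in> indef_forms D. even c}"
  define Zp where "Zp = {(a, b, c). (a, b, c) \<in> Z \<and> b > 0}"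
  define Zn where "Zn = {(a, b, c). (a, b, c) \<in> Z \<and> b < 0}"
  have fin: "finite Z" "finite X" "finite Y" "finite Zp" "finite Zn"
    unfolding Z_def X_def Y_def Zp_def Zn_def
    by (rule finite_subset[OF _ finite_indef_forms[of D]]; auto)+
  have "sum f Z = sum f X + sum f Y"
    by (subst sum.union_disjoint[symmetric]) (use fin in \<open>auto simp: X_def Y_def Z_def intro!: sum.cong\<close>)
  also have "sum f X = (\<Sum>(a, b, c)\<in>X. a)"
    by (rule sum.cong) (auto simp: X_def f_def)
  also have "sum f Y = - (\<Sum>(a, b, c)\<in>Y. a)"
    unfolding sum_negf[symmetric] by (rule sum.cong) (auto simp: Y_def f_def)
  finally have "sum f Z = (\<Sum>(a, b, c) | (a, b, c) \<in> X \<and> a + b = c. c)"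
    using indef_forms_sum[of D, folded X_def Y_def] by linarith
  also have "\<dots> = (if n \<in> range triangle then 2 * int n else 0)"
  proof (cases "n \<in> range triangle")
    case True
    then obtain m where m: "n = triangle m" by auto
    have D: "D = (2 * int m + 1)\<^sup>2" unfolding D_def m by (rule eight_triangle)
    \<comment> \<open>Here \<open>a + c = 2 * m + 1\<close>, so \<open>c = 2 * e\<close> runs
      through the even numbers from 2 to \<open>2 * m\<close>, whose sum is
      \<open>m * (m + 1) = 2 * n\<close>.\<close>
    have "(\<Sum>(a, b, c) | (a, b, c) \<in> X \<and> a + b = c. c) = (\<Sum>e\<in>{1..m}. 2 * int e)"
    proof (rule sum.reindex_bij_witness[of _ "\<lambda>e. (2 * int m + 1 - 2 * int e, 4 * int e - 2 * int m - 1, 2 * int e)"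
          "\<lambda>(a, b, c). nat (c div 2)"])
      fix z assume "z \<in> {(a, b, c). (a, b, c) \<in> X \<and> a + b = c}"
      then obtain a b c where z: "z = (a, b, c)" "(a, b, c) \<in> X" "a + b = c" by auto
      then have "b = c - a" by simp
      with z have *: "a > 0" "c > 0" "even c" "(a + c)\<^sup>2 = (2 * int m + 1)\<^sup>2"
        unfolding D[symmetric] by (auto simp: X_def indef_forms_def power2_eq_square algebra_simps)
      then have "a + c = 2 * int m + 1"
        by (subst (asm) power2_eq_iff_nonneg) auto
      then show "(case z of (a, b, c) \<Rightarrow> nat (c div 2)) \<in> {1..m}"
        "(2 * int m + 1 - 2 * int (case z of (a, b, c) \<Rightarrow> nat (c div 2)),
          4 * int (case z of (a, b, c) \<Rightarrow> nat (c div 2)) - 2 * int m - 1,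
         2 * int (case z of (a, b, c) \<Rightarrow> nat (c div 2))) = z"
        "2 * int (case z of (a, b, c) \<Rightarrow> nat (c div 2)) = (case z of (a, b, c) \<Rightarrow> c)"
        using * z by (auto elim!: evenE)
    qed (auto simp: X_def indef_forms_def D power2_eq_square algebra_simps)
    also have "\<dots> = 2 * int n"
      unfolding m by (induction m) auto
    finally show ?thesis using True by simp
  next
    case False
    have "(a, b, c) \<notin> X" if "a + b = c" for a b c
    proof
      assume "(a, b, c) \<in> X"
      then have *: "a > 0" "c > 0" "even c" "odd a" "(a + c)\<^sup>2 = D"
        using that by (auto simp: X_def indef_forms_def power2_eq_square algebra_simps)
      then have "odd (a + c)" by simp
      then obtain k where k: "a + c = 2 * k + 1" by (rule oddE)
      then obtain m where m: "k = int m" using * zero_le_imp_eq_int[of k] by auto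
      have "n = triangle m" using eight_triangle[of m] *(5) k m unfolding D_def by simp
      then show False using False by auto
    qed
    then have "{(a, b, c). (a, b, c) \<in> X \<and> a + b = c} = {}" by auto
    then show ?thesis using False by (simp only: sum.empty if_False)
  qed
  finally have Z: "sum f Z = (if n \<in> range triangle then 2 * int n else 0)" .
  have "Z = Zp \<union> Zn"
    by (auto simp: Z_def Zp_def Zn_def indef_forms_def) (metis even_zero linorder_neqE)
  moreover have "Zp \<inter> Zn = {}"
    by (auto simp: Zp_def Zn_def)
  ultimately have "sum f Z = sum f Zp + sum f Zn"
    using fin sum.union_disjoint[of Zp Zn f] by simp
  also have "sum f Zn = sum f Zp"
    by (rule sum.reindex_bij_witness[of _ "\<lambda>(a,b,c). (a,-b,c)" "\<lambda>(a,b,c). (a,-b,c)"])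
       (auto simp: Zp_def Zn_def Z_def indef_forms_def f_def)
  also have "sum f Zp = (\<Sum>(x, d, e)\<in>T. if odd d then int d else - int d)"
  proof (rule sum.reindex_bij_witness[of _ "\<lambda>(x, d, e). (int d, 2 * int x + 1, 2 * int e)"
          "\<lambda>(a, b, c). (nat (b div 2), nat a, nat (c div 2))"])
    fix z assume "z \<in> Zp"
    then obtain a b c where z: "z = (a, b, c)" and *: "a > 0" "b > 0" "c > 0" "odd b" "even c" "b\<^sup>2 + 4 * a * c = D"
      by (auto simp: Zp_def Z_def indef_forms_def)
    from * obtain x where x: "b = 2 * int x + 1"
      by (metis oddE zero_le_imp_eq_int int_one_le_iff_zero_less add_diff_cancel_right' diff_ge_0_iff_ge zero_le_mult_iff zero_less_numeral not_le order_less_imp_le)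
    from * obtain d where d: "a = int d" by (metis zero_le_imp_eq_int less_imp_le)
    from * obtain e where e: "c = 2 * int e"
      by (metis evenE zero_le_imp_eq_int zero_less_mult_iff less_imp_le not_numeral_less_zero)
    have "8 * int (triangle x) + 8 * int (d * e) = 8 * int n"
      using *(6) unfolding x d e D_def eight_triangle[symmetric] by simp
    then have "triangle x + d * e = n" by linarith
    then show "(case z of (a, b, c) \<Rightarrow> (nat (b div 2), nat a, nat (c div 2))) \<in> T"
      "(case case z of (a, b, c) \<Rightarrow> (nat (b div 2), nat a, nat (c div 2)) of
          (x, d, e) \<Rightarrow> (int d, 2 * int x + 1, 2 * int e)) = z"
      "(case case z of (a, b, c) \<Rightarrow> (nat (b div 2), nat a, nat (c div 2)) of
          (x, d, e) \<Rightarrow> if odd d then int d else - int d) = f z"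
      using * unfolding z x d e T_def f_def by auto
  next
    fix z assume "z \<in> T"
    then obtain x d e where z: "z = (x, d, e)" "d > 0" "e > 0" "triangle x + d * e = n"
      by (auto simp: T_def)
    then have "D = 8 * int (triangle x) + 1 + 8 * int d * int e"
      unfolding D_def by auto
    then have "D = (2 * int x + 1)\<^sup>2 + 4 * int d * (2 * int e)"
      unfolding eight_triangle by simp
    then show "(case z of (x, d, e) \<Rightarrow> (int d, 2 * int x + 1, 2 * int e)) \<in> Zp"
      "(case case z of (x, d, e) \<Rightarrow> (int d, 2 * int x + 1, 2 * int e) of
          (a, b, c) \<Rightarrow> (nat (b div 2), nat a, nat (c div 2))) = z"
      using z by (auto simp: Zp_def Z_def indef_forms_def)
  qed
  also have "\<dots> = (\<Sum>(x, d)\<in>(SIGMA x:{x. triangle x \<le> n}. {d\<in>{1..n - triangle x}. d dvd n - triangle x}).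
      if odd d then int d else - int d)"
    by (rule sum.reindex_bij_witness[of _ "\<lambda>(x, d). (x, d, (n - triangle x) div d)" "\<lambda>(x, d, e). (x, d)"])
       (auto simp: T_def dvd_imp_le)
  also have "\<dots> = (\<Sum>x | triangle x \<le> n. alt_divisor_sum (n - triangle x))"
    unfolding alt_divisor_sum_def using finite_triangle_le by (subst sum.Sigma) auto
  finally show ?thesis using Z by (auto split: if_splits)
qed

lemma fps_nth_triangle_series_mult:
  "fps_nth (triangle_series * F) n = (\<Sum>x | triangle x \<le> n. fps_nth F (n - triangle x))"
proof -
  have "fps_nth (triangle_series * F) n = (\<Sum>i=0..n. (if i \<in> range triangle then 1 else 0) * fps_nth F (n - i))"
    by (simp add: fps_mult_nth triangle_series_def)
  also have "\<dots> = (\<Sum>i \<in> triangle ` {x. triangle x \<le> n}. fps_nth F (n - i))"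
    by (intro sum.mono_neutral_cong_right) auto
  also have "\<dots> = (\<Sum>x | triangle x \<le> n. fps_nth F (n - triangle x))"
    by (subst sum.reindex) (auto intro: inj_on_subset[OF inj_triangle])
  finally show ?thesis .
qed

lemma fps_X_deriv_triangle_series:
  "fps_X * fps_deriv triangle_series = triangle_series * Abs_fps alt_divisor_sum"
proof (rule fps_ext)
  fix n
  show "fps_nth (fps_X * fps_deriv triangle_series) n = fps_nth (triangle_series * Abs_fps alt_divisor_sum) n"
    unfolding fps_nth_triangle_series_mult fps_nth_Abs_fps alt_divisor_sum_convolution
    by (cases n) (auto simp: triangle_series_def)
qed

section \<open>Divisor sums and the fourth power of the series\<close>

definition quads :: "int \<Rightarrow> (int \<times> int \<times> int \<times> int) set" where
  "quads P = {(a, b, c, d). a > 0 \<and> b > 0 \<and> c > 0 \<and> d > 0 \<and> a * b + c * d = P}"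

lemma finite_quads: "finite (quads P)"
proof (rule finite_subset)
  show "quads P \<subseteq> {1..P} \<times> {1..P} \<times> {1..P} \<times> {1..P}"
  proof
    fix z assume "z \<in> quads P"
    then obtain a b c d where z: "z = (a, b, c, d)"
      and *: "a > 0" "b > 0" "c > 0" "d > 0" "a * b + c * d = P" by (auto simp: quads_def)
    have "a * b \<ge> a * 1" "a * b \<ge> 1 * b" "c * d \<ge> c * 1" "c * d \<ge> 1 * d"
      using * by (intro mult_left_mono mult_right_mono; simp)+
    then show "z \<in> {1..P} \<times> {1..P} \<times> {1..P} \<times> {1..P}"
      using * unfolding z mem_Times_iff atLeastAtMost_iff fst_conv snd_conv by linarith
  qed
qed simp

text \<open>
  For fixed \<open>a\<close>, \<open>d\<close> the positive solutions \<open>(b, c)\<close> of \<open>a * b + c * d = P\<close> lie on a segment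
  with step \<open>(d, - a)\<close>; the last one (\<open>c < a\<close>) is matched with the first one (\<open>b < d\<close>).
\<close>

lemma quads_window:
  "(\<Sum>(a, b, c, d) | (a, b, c, d) \<in> quads P \<and> c < a \<and> \<not> d dvd b. F a d) =
   (\<Sum>(a, b, c, d) | (a, b, c, d) \<in> quads P \<and> b < d \<and> \<not> a dvd c. F a d)"
    (is "(\<Sum>(a, b, c, d)\<in>?S. F a d) = (\<Sum>(a, b, c, d)\<in>?T. F a d)")
proof -
  let ?i = "\<lambda>(a, b, c, d). (a, b + d * (c div a), c mod a, d)"
  let ?j = "\<lambda>(a, b, c, d). (a, b mod d, c + a * (b div d), d)"
  have S: "?i (?j (a, b, c, d)) = (a, b, c, d) \<and> ?j (a, b, c, d) \<in> ?T" if "(a, b, c, d) \<in> ?S" for a b c d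
  proof -
    have *: "a > 0" "b > 0" "c > 0" "d > 0" "a * b + c * d = P" "c < a" "\<not> d dvd b"
      using that by (auto simp: quads_def)
    define q r where "q = b div d" and "r = b mod d"
    have b: "b = q * d + r" "0 \<le> r" "r < d" "r \<noteq> 0" "0 \<le> q"
      using * unfolding q_def r_def by (auto simp: pos_imp_zdiv_nonneg_iff)
    have "\<not> a dvd c" using * by (meson not_less zdvd_imp_le)
    then have "\<not> a dvd c + a * q" by (simp add: dvd_add_left_iff)
    moreover have "0 < c + a * q" using * b by (intro add_pos_nonneg) auto
    ultimately have "(a, r, c + a * q, d) \<in> ?T"
      using * b by (auto simp: quads_def algebra_simps)
    then show ?thesis using * by (simp add: q_def r_def)
  qed
  have T: "?j (?i (a, b, c, d)) = (a, b, c, d) \<and> ?i (a, b, c, d) \<in> ?S" if "(a, b, c, d) \<in> ?T" for a b c d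
  proof -
    have *: "a > 0" "b > 0" "c > 0" "d > 0" "a * b + c * d = P" "b < d" "\<not> a dvd c"
      using that by (auto simp: quads_def)
    define q r where "q = c div a" and "r = c mod a"
    have c: "c = q * a + r" "0 \<le> r" "r < a" "r \<noteq> 0" "0 \<le> q"
      using * unfolding q_def r_def by (auto simp: pos_imp_zdiv_nonneg_iff)
    have "\<not> d dvd b" using * by (meson not_less zdvd_imp_le)
    then have "\<not> d dvd b + d * q" by (simp add: dvd_add_left_iff)
    moreover have "0 < b + d * q" using * c by (intro add_pos_nonneg) auto
    ultimately have "(a, b + d * q, r, d) \<in> ?S"
      using * c by (auto simp: quads_def algebra_simps)
    then show ?thesis using * by (simp add: q_def r_def)
  qed
  have S': "?i (?j z) = z" "?j z \<in> ?T" if "z \<in> ?S" for z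
    using S[of "fst z" "fst (snd z)" "fst (snd (snd z))" "snd (snd (snd z))"] that
    by (simp_all only: prod.collapse)
  have T': "?j (?i z) = z" "?i z \<in> ?S" if "z \<in> ?T" for z
    using T[of "fst z" "fst (snd z)" "fst (snd (snd z))" "snd (snd (snd z))"] that
    by (simp_all only: prod.collapse)
  show ?thesis
    by (rule sum.reindex_bij_witness[of _ ?i ?j, OF S' T']) auto
qed

definition factor_pairs :: "int \<Rightarrow> (int \<times> int) set" where
  "factor_pairs P = {(c, e). c > 0 \<and> e > 0 \<and> c * e = P}"

lemma finite_factor_pairs: "finite (factor_pairs P)"
proof (rule finite_subset)
  show "factor_pairs P \<subseteq> {1..P} \<times> {1..P}"
  proof
    fix z assume "z \<in> factor_pairs P"
    then obtain a b where z: "z = (a, b)"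
      and *: "a > 0" "b > 0" "a * b = P" by (auto simp: factor_pairs_def)
    have "a * b \<ge> a * 1" "a * b \<ge> 1 * b"
      using * by (intro mult_left_mono mult_right_mono; simp)+
    then show "z \<in> {1..P} \<times> {1..P}"
      using * unfolding z mem_Times_iff atLeastAtMost_iff fst_conv snd_conv by linarith
  qed
qed simp

lemma finite_int_interval_Collect [simp]:
  "finite {x::int. a \<le> x \<and> x < b \<and> Q x}" "finite {x::int. a \<le> x \<and> x \<le> b \<and> Q x}"
  by (rule finite_subset[of _ "{a..b}"]; auto)+

text \<open>If \<open>d\<close> divides \<open>b\<close>, it divides \<open>P\<close>, say
  \<open>P = d * e\<close>. The equation becomes \<open>e = a * (b div d) + c\<close>, which is
  division of \<open>e\<close> by \<open>a\<close> with remainder \<open>c\<close>; the remainder is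
  nonzero, so \<open>a\<close> does not divide \<open>e\<close>.\<close>

lemma quads_window_boundary:
  "(\<Sum>(a, b, c, d) | (a, b, c, d) \<in> quads P \<and> c < a \<and> d dvd b. F a d) =
   (\<Sum>(c, e)\<in>factor_pairs P. \<Sum>x | x \<in> {1..<e} \<and> \<not> x dvd e. F x c)"
    (is "(\<Sum>(a, b, c, d)\<in>?S. F a d) = _")
proof -
  let ?T = "SIGMA z:factor_pairs P. {x. x \<in> {1..<snd z} \<and> \<not> x dvd snd z}"
  let ?i = "\<lambda>((c, e), x). (x, c * (e div x), e mod x, c)"
  let ?j = "\<lambda>(a, b, c, d). ((d, a * (b div d) + c), a)"
  have S: "?i (?j (a, b, c, d)) = (a, b, c, d) \<and> ?j (a, b, c, d) \<in> ?T" if "(a, b, c, d) \<in> ?S" for a b c d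
  proof -
    have *: "a > 0" "b > 0" "c > 0" "d > 0" "a * b + c * d = P" "c < a" "d dvd b"
      using that by (auto simp: quads_def)
    obtain k where k: "b = d * k" using * by auto
    have "k > 0" using * k by (simp add: zero_less_mult_iff)
    then have "a \<le> a * k" using * mult_left_mono[of 1 k a] by simp
    then have le: "a < a * k + c" "0 < a * k + c" using * by linarith+
    have "\<not> a dvd c" using * by (meson not_less zdvd_imp_le)
    then have "\<not> a dvd a * k + c" by (simp add: dvd_add_right_iff)
    moreover have "d * (a * k + c) = P" using * k by (simp add: algebra_simps)
    ultimately have "((d, a * k + c), a) \<in> ?T"
      using le * by (simp add: factor_pairs_def)
    then show ?thesis using * k by simp
  qed
  have T: "?j (?i ((c, e), x)) = ((c, e), x) \<and> ?i ((c, e), x) \<in> ?S" if "((c, e), x) \<in> ?T" for c e x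
  proof -
    have *: "c > 0" "e > 0" "c * e = P" "0 < x" "x < e" "\<not> x dvd e"
      using that by (auto simp: factor_pairs_def)
    define q r where "q = e div x" and "r = e mod x"
    have e: "e = q * x + r" "0 \<le> r" "r < x" "r \<noteq> 0" "0 < q"
      using * unfolding q_def r_def by (auto simp: pos_imp_zdiv_pos_iff)
    have "(x, c * q, r, c) \<in> ?S"
      using * e by (auto simp: quads_def algebra_simps)
    then show ?thesis using * by (simp add: q_def r_def)
  qed
  have S': "?i (?j z) = z" "?j z \<in> ?T" if "z \<in> ?S" for z
    using S[of "fst z" "fst (snd z)" "fst (snd (snd z))" "snd (snd (snd z))"] that
    by (simp_all only: prod.collapse)
  have T': "?j (?i z) = z" "?i z \<in> ?S" if "z \<in> ?T" for z
    using T[of "fst (fst z)" "snd (fst z)" "snd z"] that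
    by (simp_all only: prod.collapse)
  have "(\<Sum>(a, b, c, d)\<in>?S. F a d) = (\<Sum>(z, x)\<in>?T. F x (fst z))"
    by (rule sum.reindex_bij_witness[of _ ?i ?j, OF S' T']) auto
  also have "\<dots> = (\<Sum>z\<in>factor_pairs P. \<Sum>x | x \<in> {1..<snd z} \<and> \<not> x dvd snd z. F x (fst z))"
    by (subst sum.Sigma) (auto simp: finite_factor_pairs)
  finally show ?thesis by (simp add: case_prod_unfold)
qed

section \<open>Moves on the solutions of \<open>a * b + c * d = P\<close>\<close>

lemma sum_quads_split:
  fixes f x y :: "int \<Rightarrow> int \<Rightarrow> int \<Rightarrow> int \<Rightarrow> int"
  assumes "finite A"
  shows "(\<Sum>(a, b, c, d)\<in>A. f a b c d) = (\<Sum>(a, b, c, d) | (a, b, c, d) \<in> A \<and> x a b c d < y a b c d. f a b c d)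
    + (\<Sum>(a, b, c, d) | (a, b, c, d) \<in> A \<and> x a b c d > y a b c d. f a b c d)
    + (\<Sum>(a, b, c, d) | (a, b, c, d) \<in> A \<and> x a b c d = y a b c d. f a b c d)"
proof -
  have "{z \<in> A. (case z of (a, b, c, d) \<Rightarrow> y a b c d - x a b c d) > 0} = {(a, b, c, d). (a, b, c, d) \<in> A \<and> x a b c d < y a b c d}"
    "{z \<in> A. (case z of (a, b, c, d) \<Rightarrow> y a b c d - x a b c d) < 0} = {(a, b, c, d). (a, b, c, d) \<in> A \<and> x a b c d > y a b c d}"
    "{z \<in> A. (case z of (a, b, c, d) \<Rightarrow> y a b c d - x a b c d) = 0} = {(a, b, c, d). (a, b, c, d) \<in> A \<and> x a b c d = y a b c d}"
    by auto
  then show ?thesis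
    using sum_split3[OF assms, of "\<lambda>(a, b, c, d). f a b c d" "\<lambda>(a, b, c, d). y a b c d - x a b c d"]
    by simp
qed

text \<open>From \<open>a * b + c * d = (a - c) * b + c * (b + d) = (a + c) * b + c * (d -
  b)\<close>, the numbers \<open>a - c\<close> and \<open>a + c\<close> become entries of a new
  solution. Which parity class and which inequality result depends on the order of \<open>a\<close>,
  \<open>c\<close> or of \<open>b\<close>, \<open>d\<close>. The case \<open>a = c\<close>
  contributes zero, and \<open>b = d\<close> is impossible by parity.\<close>

lemma quads_moves:
  fixes P :: int
  defines "U \<equiv> {(a, b, c, d) \<in> quads P. odd a \<and> odd b \<and> odd c \<and> even d}"
    and "V \<equiv> {(a, b, c, d) \<in> quads P. odd a \<and> odd b \<and> even c \<and> even d}"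
  shows "(\<Sum>(a, b, c, d)\<in>U. (a - c)\<^sup>2) =
      (\<Sum>(a, b, c, d) | (a, b, c, d) \<in> U \<and> a > c. d\<^sup>2) + (\<Sum>(a, b, c, d) | (a, b, c, d) \<in> V \<and> a > c. d\<^sup>2)"
    "(\<Sum>(a, b, c, d)\<in>U. (a + c)\<^sup>2) =
      (\<Sum>(a, b, c, d) | (a, b, c, d) \<in> U \<and> d > b. d\<^sup>2) + (\<Sum>(a, b, c, d) | (a, b, c, d) \<in> V \<and> d > b. d\<^sup>2)"
    "(\<Sum>(a, b, c, d)\<in>V. (a - c)\<^sup>2) =
      (\<Sum>(a, b, c, d) | (a, b, c, d) \<in> U \<and> c > b. a\<^sup>2) + (\<Sum>(a, b, c, d) | (a, b, c, d) \<in> U \<and> a > d. c\<^sup>2)"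
    "(\<Sum>(a, b, c, d)\<in>V. (a + c)\<^sup>2) =
      (\<Sum>(a, b, c, d) | (a, b, c, d) \<in> U \<and> a > d. a\<^sup>2) + (\<Sum>(a, b, c, d) | (a, b, c, d) \<in> U \<and> c > b. c\<^sup>2)"
proof -
  note defs = U_def V_def quads_def
  have zero: "(\<Sum>(a, b, c, d) | (a, b, c, d) \<in> A \<and> c = a. (a - c)\<^sup>2) = 0" for A :: "(int \<times> int \<times> int \<times> int) set"
    by (intro sum.neutral) auto
  have fin: "finite U" "finite V"
    unfolding U_def V_def by (rule finite_subset[OF _ finite_quads[of P]]; auto)+
  have "(\<Sum>(a, b, c, d) | (a, b, c, d) \<in> U \<and> a > c. (a - c)\<^sup>2) = (\<Sum>(a, b, c, d) | (a, b, c, d) \<in> U \<and> a > c. d\<^sup>2)"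
    by (rule sum.reindex_bij_witness[of _ "\<lambda>(a, b, c, d). (b + d, c, b, a - c)" "\<lambda>(a, b, c, d). (b + d, c, b, a - c)"])
       (auto simp: defs algebra_simps)
  moreover have "(\<Sum>(a, b, c, d) | (a, b, c, d) \<in> U \<and> a < c. (a - c)\<^sup>2) = (\<Sum>(a, b, c, d) | (a, b, c, d) \<in> V \<and> a > c. d\<^sup>2)"
    by (rule sum.reindex_bij_witness[of _ "\<lambda>(a, b, c, d). (b, a - c, b + d, c)" "\<lambda>(a, b, c, d). (b + d, a, d, c - a)"])
       (auto simp: defs algebra_simps power2_eq_square)
  ultimately show "(\<Sum>(a, b, c, d)\<in>U. (a - c)\<^sup>2) =
      (\<Sum>(a, b, c, d) | (a, b, c, d) \<in> U \<and> a > c. d\<^sup>2) + (\<Sum>(a, b, c, d) | (a, b, c, d) \<in> V \<and> a > c. d\<^sup>2)"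
    using sum_quads_split[OF fin(1), of "\<lambda>a b c d. (a - c)\<^sup>2" "\<lambda>a b c d. c" "\<lambda>a b c d. a"] zero[of U] zero[of V] by linarith
  have "(\<Sum>(a, b, c, d) | (a, b, c, d) \<in> U \<and> d > b. (a + c)\<^sup>2) = (\<Sum>(a, b, c, d) | (a, b, c, d) \<in> U \<and> d > b. d\<^sup>2)"
    by (rule sum.reindex_bij_witness[of _ "\<lambda>(a, b, c, d). (d - b, c, b, a + c)" "\<lambda>(a, b, c, d). (d - b, c, b, a + c)"])
       (auto simp: defs algebra_simps)
  moreover have "(\<Sum>(a, b, c, d) | (a, b, c, d) \<in> U \<and> d < b. (a + c)\<^sup>2) = (\<Sum>(a, b, c, d) | (a, b, c, d) \<in> V \<and> d > b. d\<^sup>2)"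
    by (rule sum.reindex_bij_witness[of _ "\<lambda>(a, b, c, d). (b, a + c, d - b, c)" "\<lambda>(a, b, c, d). (b - d, a, d, a + c)"])
       (auto simp: defs algebra_simps power2_eq_square)
  moreover have "(\<Sum>(a, b, c, d) | (a, b, c, d) \<in> U \<and> b = d. (a + c)\<^sup>2) = 0"
    by (intro sum.neutral) (auto simp: defs)
  ultimately show "(\<Sum>(a, b, c, d)\<in>U. (a + c)\<^sup>2) =
      (\<Sum>(a, b, c, d) | (a, b, c, d) \<in> U \<and> d > b. d\<^sup>2) + (\<Sum>(a, b, c, d) | (a, b, c, d) \<in> V \<and> d > b. d\<^sup>2)"
    using sum_quads_split[OF fin(1), of "\<lambda>a b c d. (a + c)\<^sup>2" "\<lambda>a b c d. b" "\<lambda>a b c d. d"] by linarith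
  have "(\<Sum>(a, b, c, d) | (a, b, c, d) \<in> V \<and> a > c. (a - c)\<^sup>2) = (\<Sum>(a, b, c, d) | (a, b, c, d) \<in> U \<and> c > b. a\<^sup>2)"
    by (rule sum.reindex_bij_witness[of _ "\<lambda>(a, b, c, d). (a + d, b, d, c - b)" "\<lambda>(a, b, c, d). (a - c, b, b + d, c)"])
       (auto simp: defs algebra_simps power2_eq_square)
  moreover have "(\<Sum>(a, b, c, d) | (a, b, c, d) \<in> V \<and> a < c. (a - c)\<^sup>2) = (\<Sum>(a, b, c, d) | (a, b, c, d) \<in> U \<and> a > d. c\<^sup>2)"
    by (rule sum.reindex_bij_witness[of _ "\<lambda>(a, b, c, d). (b, a - d, b + c, d)" "\<lambda>(a, b, c, d). (b + d, a, c - a, d)"])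
       (auto simp: defs algebra_simps power2_eq_square)
  ultimately show "(\<Sum>(a, b, c, d)\<in>V. (a - c)\<^sup>2) =
      (\<Sum>(a, b, c, d) | (a, b, c, d) \<in> U \<and> c > b. a\<^sup>2) + (\<Sum>(a, b, c, d) | (a, b, c, d) \<in> U \<and> a > d. c\<^sup>2)"
    using sum_quads_split[OF fin(2), of "\<lambda>a b c d. (a - c)\<^sup>2" "\<lambda>a b c d. c" "\<lambda>a b c d. a"] zero[of U] zero[of V] by linarith
  have "(\<Sum>(a, b, c, d) | (a, b, c, d) \<in> V \<and> d > b. (a + c)\<^sup>2) = (\<Sum>(a, b, c, d) | (a, b, c, d) \<in> U \<and> a > d. a\<^sup>2)"
    by (rule sum.reindex_bij_witness[of _ "\<lambda>(a, b, c, d). (a - d, b, d, b + c)" "\<lambda>(a, b, c, d). (a + c, b, d - b, c)"])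
       (auto simp: defs algebra_simps)
  moreover have "(\<Sum>(a, b, c, d) | (a, b, c, d) \<in> V \<and> d < b. (a + c)\<^sup>2) = (\<Sum>(a, b, c, d) | (a, b, c, d) \<in> U \<and> c > b. c\<^sup>2)"
    by (rule sum.reindex_bij_witness[of _ "\<lambda>(a, b, c, d). (b, a + d, c - b, d)" "\<lambda>(a, b, c, d). (b - d, a, a + c, d)"])
       (auto simp: defs algebra_simps power2_eq_square)
  moreover have "(\<Sum>(a, b, c, d) | (a, b, c, d) \<in> V \<and> b = d. (a + c)\<^sup>2) = 0"
    by (intro sum.neutral) (auto simp: defs)
  ultimately show "(\<Sum>(a, b, c, d)\<in>V. (a + c)\<^sup>2) =
      (\<Sum>(a, b, c, d) | (a, b, c, d) \<in> U \<and> a > d. a\<^sup>2) + (\<Sum>(a, b, c, d) | (a, b, c, d) \<in> U \<and> c > b. c\<^sup>2)"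
    using sum_quads_split[OF fin(2), of "\<lambda>a b c d. (a + c)\<^sup>2" "\<lambda>a b c d. b" "\<lambda>a b c d. d"] by linarith
qed


section \<open>Evaluation of the boundary sums over factorizations of \<open>P\<close>\<close>

lemma alternating_squares:
  "2 * (\<Sum>x\<in>{1..<2 * int m + 1}. if odd x then x\<^sup>2 - c else - x\<^sup>2) = - (2 * int m) * (2 * int m + 1 + c)"
proof (induction m)
  case (Suc m)
  have "{1..<2 * int (Suc m) + 1} = insert (2 * int m + 2) (insert (2 * int m + 1) {1..<2 * int m + 1})"
    by auto
  then have "(\<Sum>x\<in>{1..<2 * int (Suc m) + 1}. if odd x then x\<^sup>2 - c else - x\<^sup>2) =
     (\<Sum>x\<in>{1..<2 * int m + 1}. if odd x then x\<^sup>2 - c else - x\<^sup>2) + (2 * int m + 1)\<^sup>2 - c - (2 * int m + 2)\<^sup>2"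
    by (simp del: of_nat_Suc)
  then show ?case using Suc by (simp add: power2_eq_square algebra_simps)
qed simp

lemma factor_pairs_swap: "(\<Sum>(c, e)\<in>factor_pairs P. F c e) = (\<Sum>(c, e)\<in>factor_pairs P. F e c)"
  by (rule sum.reindex_bij_witness[of _ "\<lambda>(c, e). (e, c)" "\<lambda>(c, e). (e, c)"])
     (auto simp: factor_pairs_def mult.commute)

text \<open>Writing \<open>e = x * y\<close>, the sum runs over the factorizations
  \<open>P = c * x * y\<close>, and its terms change sign when \<open>c\<close> and \<open>x\<close>
  are exchanged.\<close>

lemma factor_triples_antisym:
  "(\<Sum>(c, e)\<in>factor_pairs P. \<Sum>x | x \<in> {1..e} \<and> x dvd e. x\<^sup>2 - c\<^sup>2) = (0 :: int)"
proof -
  define T where "T = (SIGMA z:factor_pairs P. {x. x \<in> {1..snd z} \<and> x dvd snd z})"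
  have "(\<Sum>((c, e), x)\<in>T. x\<^sup>2 - c\<^sup>2) = (\<Sum>((c, e), x)\<in>T. c\<^sup>2 - x\<^sup>2)"
    by (rule sum.reindex_bij_witness[of _ "\<lambda>((c, e), x). ((x, c * (e div x)), c)" "\<lambda>((c, e), x). ((x, c * (e div x)), c)"])
       (auto simp: T_def factor_pairs_def zero_less_mult_iff elim!: dvdE)
  also have "\<dots> = - (\<Sum>((c, e), x)\<in>T. x\<^sup>2 - c\<^sup>2)"
    unfolding sum_negf[symmetric] by (rule sum.cong) auto
  finally have "(\<Sum>((c, e), x)\<in>T. x\<^sup>2 - c\<^sup>2) = 0" by simp
  also have "(\<Sum>((c, e), x)\<in>T. x\<^sup>2 - c\<^sup>2) = (\<Sum>z\<in>factor_pairs P. \<Sum>x | x \<in> {1..snd z} \<and> x dvd snd z. x\<^sup>2 - (fst z)\<^sup>2)"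
    unfolding T_def by (subst sum.Sigma) (auto simp: finite_factor_pairs case_prod_unfold)
  finally show ?thesis by (simp add: case_prod_unfold)
qed

text \<open>The sum over non-divisors is the full sum, known from
  \<open>alternating_squares\<close>, minus the sum over divisors of \<open>e\<close>, all odd. Over
  all factor pairs the squares cancel by symmetry and the divisor part by
  \<open>factor_triples_antisym\<close>; what remains is the sum of
  \<open>e - c * P\<close>.\<close>

lemma factor_pairs_boundary:
  assumes "odd P"
  shows "2 * (\<Sum>(c, e)\<in>factor_pairs P. \<Sum>x | x \<in> {1..<e} \<and> \<not> x dvd e. if odd x then x\<^sup>2 - c\<^sup>2 else - x\<^sup>2) =
    - ((P - 1) * (\<Sum>(c, e)\<in>factor_pairs P. e))"
proof -
  have inner: "2 * (\<Sum>x | x \<in> {1..<e} \<and> \<not> x dvd e. if odd x then x\<^sup>2 - c\<^sup>2 else - x\<^sup>2) =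
      (e\<^sup>2 - c\<^sup>2) + e - c * P - 2 * (\<Sum>x | x \<in> {1..e} \<and> x dvd e. x\<^sup>2 - c\<^sup>2)"
    if "(c, e) \<in> factor_pairs P" for c e
  proof -
    let ?f = "\<lambda>x. if odd x then x\<^sup>2 - c\<^sup>2 else - x\<^sup>2"
    have *: "c > 0" "e > 0" "odd e" "P = c * e" using that assms by (auto simp: factor_pairs_def)
    then obtain m where m: "e = 2 * int m + 1"
      by (metis oddE zero_le_imp_eq_int int_one_le_iff_zero_less add_diff_cancel_right' diff_ge_0_iff_ge zero_le_mult_iff zero_less_numeral not_le order_less_imp_le)
    have "sum ?f {1..<e} = (\<Sum>x | x \<in> {1..<e} \<and> \<not> x dvd e. ?f x) + (\<Sum>x | x \<in> {1..<e} \<and> x dvd e. ?f x)"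
      by (subst sum.union_disjoint[symmetric]) (auto intro!: sum.cong)
    also have "(\<Sum>x | x \<in> {1..<e} \<and> x dvd e. ?f x) = (\<Sum>x | x \<in> {1..<e} \<and> x dvd e. x\<^sup>2 - c\<^sup>2)"
      using \<open>odd e\<close> by (intro sum.cong) (auto dest: dvd_trans)
    also have "{x. x \<in> {1..e} \<and> x dvd e} = insert e {x. x \<in> {1..<e} \<and> x dvd e}"
      using * by auto
    then have "(\<Sum>x | x \<in> {1..<e} \<and> x dvd e. x\<^sup>2 - c\<^sup>2) = (\<Sum>x | x \<in> {1..e} \<and> x dvd e. x\<^sup>2 - c\<^sup>2) - (e\<^sup>2 - c\<^sup>2)"
      by simp
    finally show ?thesis
      using alternating_squares[where m = m and c = "c\<^sup>2"] unfolding m[symmetric] *(4)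
      by (simp add: m power2_eq_square algebra_simps)
  qed
  have "2 * (\<Sum>(c, e)\<in>factor_pairs P. \<Sum>x | x \<in> {1..<e} \<and> \<not> x dvd e. if odd x then x\<^sup>2 - c\<^sup>2 else - x\<^sup>2) =
      (\<Sum>(c, e)\<in>factor_pairs P. (e\<^sup>2 - c\<^sup>2) + e - c * P - 2 * (\<Sum>x | x \<in> {1..e} \<and> x dvd e. x\<^sup>2 - c\<^sup>2))"
    unfolding sum_distrib_left by (rule sum.cong) (use inner in \<open>auto simp: sum_distrib_left\<close>)
  also have "\<dots> = (\<Sum>(c, e)\<in>factor_pairs P. e\<^sup>2) - (\<Sum>(c, e)\<in>factor_pairs P. c\<^sup>2) + (\<Sum>(c, e)\<in>factor_pairs P. e)
      - (\<Sum>(c, e)\<in>factor_pairs P. c) * P - 2 * (\<Sum>(c, e)\<in>factor_pairs P. \<Sum>x | x \<in> {1..e} \<and> x dvd e. x\<^sup>2 - c\<^sup>2)"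
    by (simp add: case_prod_unfold sum.distrib sum_subtractf sum_distrib_left sum_distrib_right)
  also have "\<dots> = - ((P - 1) * (\<Sum>(c, e)\<in>factor_pairs P. e))"
    using factor_pairs_swap[of "\<lambda>c e. c\<^sup>2" P] factor_pairs_swap[of "\<lambda>c e. c" P] factor_triples_antisym[of P]
    by (simp add: algebra_simps)
  finally show ?thesis .
qed

text \<open>Uses \<open>4 * a * c = (a + c)\<^sup>2 - (a - c)\<^sup>2\<close>, whose two squares are single entries after a move.\<close>

lemma quads_weighted_sum:
  assumes "odd P"
  shows "8 * (\<Sum>(a, b, c, d) | (a, b, c, d) \<in> quads P \<and> odd a \<and> odd b \<and> even d. if odd c then a * c else - a * c) =
    (P - 1) * (\<Sum>(c, e)\<in>factor_pairs P. e)"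
proof -
  define U V where "U = {(a, b, c, d) \<in> quads P. odd a \<and> odd b \<and> odd c \<and> even d}"
    and "V = {(a, b, c, d) \<in> quads P. odd a \<and> odd b \<and> even c \<and> even d}"
  \<comment> \<open>The window lemmas admit weights in \<open>a\<close> and \<open>d\<close> only.
    Since \<open>P\<close> is odd, the parities of \<open>a\<close> and \<open>d\<close> (with that
    of \<open>c\<close>, for \<open>F2\<close>) determine the parity of \<open>b\<close>, so these
    weights encode membership in \<open>U\<close> and \<open>V\<close>.\<close>
  define F1 F2 :: "int \<Rightarrow> int \<Rightarrow> int" where "F1 = (\<lambda>a d. if odd a \<and> even d then d\<^sup>2 else 0)"
    and "F2 = (\<lambda>a d. if odd a \<and> odd d then a\<^sup>2 - d\<^sup>2 else 0)"
  note defs = U_def V_def quads_def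
  note moves = quads_moves[of P, folded U_def V_def]
  have fin: "finite U" "finite V" "finite (quads P)"
    unfolding U_def V_def by (rule finite_subset[OF _ finite_quads[of P]]; auto)+
  have finC: "finite {(a, b, c, d). (a, b, c, d) \<in> quads P \<and> Q a b c d}"
    "finite {(a, b, c, d). (a, b, c, d) \<in> U \<and> Q a b c d}"
    "finite {(a, b, c, d). (a, b, c, d) \<in> V \<and> Q a b c d}" for Q
    by (rule finite_subset[OF _ finite_quads[of P]]; auto simp: U_def V_def)+
  have UV: "(\<Sum>(a, b, c, d) | (a, b, c, d) \<in> U \<and> Q a b c d. f a b c d) + (\<Sum>(a, b, c, d) | (a, b, c, d) \<in> V \<and> Q a b c d. f a b c d)
     = (\<Sum>(a, b, c, d) | (a, b, c, d) \<in> quads P \<and> Q a b c d. if odd a \<and> odd b \<and> even d then f a b c d else 0)"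
    for Q and f :: "int \<Rightarrow> int \<Rightarrow> int \<Rightarrow> int \<Rightarrow> int"
    by (subst sum.union_disjoint[symmetric, OF finC(2,3)])
       (auto simp: U_def V_def finC intro!: sum.mono_neutral_cong_left split: if_splits)
  have odd_b: "odd b" if "(a, b, c, d) \<in> quads P" "odd a" "even d" for a b c d
    using that assms by (auto simp: quads_def)
  have swap: "(\<Sum>(a, b, c, d) | (a, b, c, d) \<in> quads P \<and> b < d \<and> a dvd c. F a d) =
      (\<Sum>(a, b, c, d) | (a, b, c, d) \<in> quads P \<and> c < a \<and> d dvd b. F d a)"
    "(\<Sum>(a, b, c, d) | (a, b, c, d) \<in> quads P \<and> b < d \<and> \<not> a dvd c. F a d) =
      (\<Sum>(a, b, c, d) | (a, b, c, d) \<in> quads P \<and> c < a \<and> \<not> d dvd b. F d a)" for F :: "int \<Rightarrow> int \<Rightarrow> int"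
    by (rule sum.reindex_bij_witness[of _ "\<lambda>(a, b, c, d). (d, c, b, a)" "\<lambda>(a, b, c, d). (d, c, b, a)"];
        auto simp: quads_def algebra_simps)+
  have dvd_split: "(\<Sum>(a, b, c, d) | (a, b, c, d) \<in> quads P \<and> Q a b c d. F a d) =
      (\<Sum>(a, b, c, d) | (a, b, c, d) \<in> quads P \<and> Q a b c d \<and> R a b c d. F a d) +
      (\<Sum>(a, b, c, d) | (a, b, c, d) \<in> quads P \<and> Q a b c d \<and> \<not> R a b c d. F a d)" for Q R and F :: "int \<Rightarrow> int \<Rightarrow> int"
    by (subst sum.union_disjoint[symmetric, OF finC(1,1)]) (auto intro!: sum.cong)
  have "(\<Sum>(a, b, c, d) | (a, b, c, d) \<in> U \<and> a > c. d\<^sup>2) + (\<Sum>(a, b, c, d) | (a, b, c, d) \<in> V \<and> a > c. d\<^sup>2) =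
    (\<Sum>(a, b, c, d) | (a, b, c, d) \<in> quads P \<and> c < a. F1 a d)"
    unfolding UV by (rule sum.cong) (auto simp: F1_def dest: odd_b)
  also have "\<dots> = (\<Sum>(a, b, c, d) | (a, b, c, d) \<in> quads P \<and> c < a \<and> d dvd b. F1 a d) +
     (\<Sum>(a, b, c, d) | (a, b, c, d) \<in> quads P \<and> c < a \<and> \<not> d dvd b. F1 a d)"
    by (rule dvd_split)
  \<comment> \<open>No boundary term arises on this side, because the even \<open>d\<close> cannot
    divide the odd \<open>b\<close>. The boundary on the side \<open>b < d\<close> is what makes up
    \<open>T1\<close>.\<close>
  also have "(\<Sum>(a, b, c, d) | (a, b, c, d) \<in> quads P \<and> c < a \<and> d dvd b. F1 a d) = 0"
    by (rule sum.neutral) (auto simp: F1_def dest: odd_b dvd_trans[of 2])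
  also have "(\<Sum>(a, b, c, d) | (a, b, c, d) \<in> quads P \<and> c < a \<and> \<not> d dvd b. F1 a d) =
     (\<Sum>(a, b, c, d) | (a, b, c, d) \<in> quads P \<and> b < d \<and> \<not> a dvd c. F1 a d)"
    by (rule quads_window)
  also have "\<dots> = (\<Sum>(a, b, c, d) | (a, b, c, d) \<in> quads P \<and> b < d. F1 a d) -
      (\<Sum>(a, b, c, d) | (a, b, c, d) \<in> quads P \<and> b < d \<and> a dvd c. F1 a d)"
    using dvd_split[where Q = "\<lambda>a b c d. b < d" and F = F1 and R = "\<lambda>a b c d. a dvd c"] by simp
  also have "(\<Sum>(a, b, c, d) | (a, b, c, d) \<in> quads P \<and> b < d. F1 a d) =
      (\<Sum>(a, b, c, d) | (a, b, c, d) \<in> U \<and> d > b. d\<^sup>2) + (\<Sum>(a, b, c, d) | (a, b, c, d) \<in> V \<and> d > b. d\<^sup>2)"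
    unfolding UV by (rule sum.cong) (auto simp: F1_def dest: odd_b)
  also have "(\<Sum>(a, b, c, d) | (a, b, c, d) \<in> quads P \<and> b < d \<and> a dvd c. F1 a d) =
      (\<Sum>(c, e)\<in>factor_pairs P. \<Sum>x | x \<in> {1..<e} \<and> \<not> x dvd e. F1 c x)"
    unfolding swap by (rule quads_window_boundary)
  finally have T1: "(\<Sum>(a, b, c, d)\<in>U. (a - c)\<^sup>2) - (\<Sum>(a, b, c, d)\<in>U. (a + c)\<^sup>2) =
      - (\<Sum>(c, e)\<in>factor_pairs P. \<Sum>x | x \<in> {1..<e} \<and> \<not> x dvd e. F1 c x)"
    unfolding moves by simp
  \<comment> \<open>Permuting entries carries both ranges in \<open>moves\<close> for
    \<open>V\<close> to the window \<open>c < a\<close>: \<open>a > d\<close> gives the part with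
    even \<open>c\<close>, and \<open>c > b\<close> the part with odd \<open>c\<close>. In both, the
    difference of squares becomes \<open>F2 a d\<close>.\<close>
  have "(\<Sum>(a, b, c, d) | (a, b, c, d) \<in> U \<and> a > d. a\<^sup>2) - (\<Sum>(a, b, c, d) | (a, b, c, d) \<in> U \<and> a > d. c\<^sup>2) =
      (\<Sum>(a, b, c, d) | (a, b, c, d) \<in> quads P \<and> c < a \<and> even c. F2 a d)"
  proof -
    have "(\<Sum>(a, b, c, d) | (a, b, c, d) \<in> U \<and> a > d. a\<^sup>2) - (\<Sum>(a, b, c, d) | (a, b, c, d) \<in> U \<and> a > d. c\<^sup>2) =
        (\<Sum>(a, b, c, d) | (a, b, c, d) \<in> U \<and> a > d. a\<^sup>2 - c\<^sup>2)"
      by (simp add: sum_subtractf case_prod_unfold)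
    also have "\<dots> = (\<Sum>(a, b, c, d) | (a, b, c, d) \<in> quads P \<and> c < a \<and> even c \<and> odd a \<and> odd d. F2 a d)"
      by (rule sum.reindex_bij_witness[of _ "\<lambda>(a, b, c, d). (a, b, d, c)" "\<lambda>(a, b, c, d). (a, b, d, c)"])
         (use assms in \<open>auto simp: F2_def defs algebra_simps\<close>)
    also have "\<dots> = (\<Sum>(a, b, c, d) | (a, b, c, d) \<in> quads P \<and> c < a \<and> even c. F2 a d)"
      by (rule sum.mono_neutral_cong_left) (auto simp: finC F2_def split: if_splits)
    finally show ?thesis .
  qed
  moreover have "(\<Sum>(a, b, c, d) | (a, b, c, d) \<in> U \<and> c > b. c\<^sup>2) - (\<Sum>(a, b, c, d) | (a, b, c, d) \<in> U \<and> c > b. a\<^sup>2) =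
      (\<Sum>(a, b, c, d) | (a, b, c, d) \<in> quads P \<and> c < a \<and> \<not> even c. F2 a d)"
  proof -
    have "(\<Sum>(a, b, c, d) | (a, b, c, d) \<in> U \<and> c > b. c\<^sup>2) - (\<Sum>(a, b, c, d) | (a, b, c, d) \<in> U \<and> c > b. a\<^sup>2) =
        (\<Sum>(a, b, c, d) | (a, b, c, d) \<in> U \<and> c > b. c\<^sup>2 - a\<^sup>2)"
      by (simp add: sum_subtractf case_prod_unfold)
    also have "\<dots> = (\<Sum>(a, b, c, d) | (a, b, c, d) \<in> quads P \<and> c < a \<and> odd c \<and> odd a \<and> odd d. F2 a d)"
      by (rule sum.reindex_bij_witness[of _ "\<lambda>(a, b, c, d). (d, c, a, b)" "\<lambda>(a, b, c, d). (c, d, b, a)"])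
         (use assms in \<open>auto simp: F2_def defs algebra_simps\<close>)
    also have "\<dots> = (\<Sum>(a, b, c, d) | (a, b, c, d) \<in> quads P \<and> c < a \<and> odd c. F2 a d)"
      by (rule sum.mono_neutral_cong_left) (auto simp: finC F2_def split: if_splits)
    finally show ?thesis .
  qed
  ultimately have "(\<Sum>(a, b, c, d)\<in>V. (a + c)\<^sup>2) - (\<Sum>(a, b, c, d)\<in>V. (a - c)\<^sup>2) =
      (\<Sum>(a, b, c, d) | (a, b, c, d) \<in> quads P \<and> c < a. F2 a d)"
    unfolding moves using dvd_split[where Q = "\<lambda>a b c d. c < a" and F = F2 and R = "\<lambda>a b c d. even c"] by linarith
  also have "\<dots> = (\<Sum>(a, b, c, d) | (a, b, c, d) \<in> quads P \<and> c < a \<and> d dvd b. F2 a d) +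
     (\<Sum>(a, b, c, d) | (a, b, c, d) \<in> quads P \<and> c < a \<and> \<not> d dvd b. F2 a d)"
    by (rule dvd_split)
  \<comment> \<open>\<open>F2\<close> is antisymmetric, while \<open>quads_window\<close> followed
    by reversing the quadruple maps this range to itself and exchanges \<open>a\<close> and
    \<open>d\<close>. So this part vanishes.\<close>
  also have "(\<Sum>(a, b, c, d) | (a, b, c, d) \<in> quads P \<and> c < a \<and> \<not> d dvd b. F2 a d) =
     - (\<Sum>(a, b, c, d) | (a, b, c, d) \<in> quads P \<and> c < a \<and> \<not> d dvd b. F2 a d)"
    unfolding sum_negf[symmetric] by (subst quads_window, subst swap) (auto simp: F2_def intro!: sum.cong)
  then have "(\<Sum>(a, b, c, d) | (a, b, c, d) \<in> quads P \<and> c < a \<and> \<not> d dvd b. F2 a d) = 0" by simp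
  also note quads_window_boundary
  finally have T2: "(\<Sum>(a, b, c, d)\<in>V. (a + c)\<^sup>2) - (\<Sum>(a, b, c, d)\<in>V. (a - c)\<^sup>2) =
      (\<Sum>(c, e)\<in>factor_pairs P. \<Sum>x | x \<in> {1..<e} \<and> \<not> x dvd e. F2 x c)" by simp
  have T3: "(\<Sum>(c, e)\<in>factor_pairs P. \<Sum>x | x \<in> {1..<e} \<and> \<not> x dvd e. F2 x c) -
      (\<Sum>(c, e)\<in>factor_pairs P. \<Sum>x | x \<in> {1..<e} \<and> \<not> x dvd e. F1 c x) =
      (\<Sum>(c, e)\<in>factor_pairs P. \<Sum>x | x \<in> {1..<e} \<and> \<not> x dvd e. if odd x then x\<^sup>2 - c\<^sup>2 else - x\<^sup>2)"
    unfolding sum_subtractf[symmetric] case_prod_unfold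
    by (intro sum.cong refl) (use assms in \<open>auto simp: factor_pairs_def F1_def F2_def\<close>)
  have "4 * (\<Sum>(a, b, c, d) | (a, b, c, d) \<in> quads P \<and> odd a \<and> odd b \<and> even d. if odd c then a * c else - a * c) =
    (\<Sum>(a, b, c, d)\<in>U. (a + c)\<^sup>2) - (\<Sum>(a, b, c, d)\<in>U. (a - c)\<^sup>2) -
      ((\<Sum>(a, b, c, d)\<in>V. (a + c)\<^sup>2) - (\<Sum>(a, b, c, d)\<in>V. (a - c)\<^sup>2))"
  proof -
    have "(\<Sum>(a, b, c, d) | (a, b, c, d) \<in> quads P \<and> odd a \<and> odd b \<and> even d. if odd c then a * c else - a * c) =
        (\<Sum>(a, b, c, d)\<in>U \<union> V. if odd c then a * c else - a * c)"
      by (rule sum.cong) (auto simp: U_def V_def)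
    also have "\<dots> = (\<Sum>(a, b, c, d)\<in>U. if odd c then a * c else - a * c) +
        (\<Sum>(a, b, c, d)\<in>V. if odd c then a * c else - a * c)"
      by (rule sum.union_disjoint[OF fin(1,2)]) (auto simp: U_def V_def)
    also have "(\<Sum>(a, b, c, d)\<in>U. if odd c then a * c else - a * c) = (\<Sum>(a, b, c, d)\<in>U. a * c)"
      by (rule sum.cong) (auto simp: U_def)
    also have "(\<Sum>(a, b, c, d)\<in>V. if odd c then a * c else - a * c) = - (\<Sum>(a, b, c, d)\<in>V. a * c)"
      unfolding sum_negf[symmetric] by (rule sum.cong) (auto simp: V_def)
    finally have "(\<Sum>(a, b, c, d) | (a, b, c, d) \<in> quads P \<and> odd a \<and> odd b \<and> even d. if odd c then a * c else - a * c) =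
        (\<Sum>(a, b, c, d)\<in>U. a * c) - (\<Sum>(a, b, c, d)\<in>V. a * c)" by simp
    moreover have "(\<Sum>(a, b, c, d)\<in>A. (a + c)\<^sup>2) - (\<Sum>(a, b, c, d)\<in>A. (a - c)\<^sup>2) = 4 * (\<Sum>(a, b, c, d)\<in>A. a * c)"
      for A :: "(int \<times> int \<times> int \<times> int) set"
      unfolding sum_subtractf[symmetric] sum_distrib_left
      by (rule sum.cong) (auto simp: power2_eq_square algebra_simps)
    ultimately show ?thesis by simp
  qed
  then show ?thesis using T1 T2 T3 factor_pairs_boundary[OF assms] by linarith
qed

section \<open>The differential equation for the fourth power\<close>

definition odd_divisor_series :: "int fps" where
  "odd_divisor_series = Abs_fps (\<lambda>n. \<Sum>(c, e)\<in>factor_pairs (2 * int n + 1). e)"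

text \<open>A term of the product consists of a divisor \<open>c\<close> of \<open>k = c * m\<close>
  and a factorization \<open>b * a = 2 * (n - k) + 1\<close>. Together they say
  \<open>a * b + c * (2 * m) = 2 * n + 1\<close>, so \<open>d = 2 * m\<close> is the even
  entry.\<close>

lemma alt_divisor_sum_mult_odd_divisor_series:
  "fps_nth (Abs_fps alt_divisor_sum * odd_divisor_series) n =
    (\<Sum>(a, b, c, d) | (a, b, c, d) \<in> quads (2 * int n + 1) \<and> odd a \<and> odd b \<and> even d. if odd c then a * c else - a * c)"
proof -
  let ?S = "SIGMA k:{0..n}. {c \<in> {1..k}. c dvd k} \<times> factor_pairs (2 * int (n - k) + 1)"
  let ?T = "{(a, b, c, d). (a, b, c, d) \<in> quads (2 * int n + 1) \<and> odd a \<and> odd b \<and> even d}"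
  let ?i = "\<lambda>(a, b, c, d). (nat (c * d div 2), nat c, (b, a))"
  let ?j = "\<lambda>(k, c, (b, a)). (a, b, int c, 2 * int (k div c))"
  have S: "?i (?j (k, c, (b, a))) = (k, c, (b, a)) \<and> ?j (k, c, (b, a)) \<in> ?T" if "(k, c, (b, a)) \<in> ?S" for k c b a
  proof -
    have *: "k \<le> n" "c dvd k" "c > 0" "k > 0" "a > 0" "b > 0" "b * a = 2 * int (n - k) + 1"
      using that by (auto simp: factor_pairs_def)
    then obtain m where m: "k = c * m" by blast
    have "odd (b * a)" using *(7) by simp
    then have "odd a" "odd b" by auto
    moreover have "a * b + int c * (2 * int m) = 2 * int n + 1"
      using * m by (simp add: mult.commute[of a] of_nat_diff)
    moreover have "m > 0" using * m by (cases m) auto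
    ultimately have "(a, b, int c, 2 * int m) \<in> ?T" using * by (simp add: quads_def)
    then show ?thesis using * m by (simp add: nat_mult_distrib)
  qed
  have T: "?j (?i (a, b, c, d)) = (a, b, c, d) \<and> ?i (a, b, c, d) \<in> ?S" if "(a, b, c, d) \<in> ?T" for a b c d
  proof -
    have *: "a > 0" "b > 0" "c > 0" "d > 0" "even d" "a * b + c * d = 2 * int n + 1"
      using that by (auto simp: quads_def)
    obtain c' where c: "c = int c'" using * zero_le_imp_eq_int[of c] by auto
    obtain d' where d: "d = 2 * int d'" using * zero_le_imp_eq_int[of "d div 2"] by fastforce
    have "0 < a * b" using * by simp
    then have "int (c' * d') \<le> int n" using *(6) c d by simp
    then have le: "c' * d' \<le> n" by linarith
    have "b * a = 2 * int (n - c' * d') + 1"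
      using *(6) le c d by (simp add: of_nat_diff algebra_simps)
    then have "(c' * d', c', (b, a)) \<in> ?S" using * c d le by (auto simp: factor_pairs_def)
    then show ?thesis using * c d le by (simp add: nat_mult_distrib)
  qed
  have S': "?i (?j z) = z" "?j z \<in> ?T" if "z \<in> ?S" for z
    using S[of "fst z" "fst (snd z)" "fst (snd (snd z))" "snd (snd (snd z))"] that
    by (simp_all only: prod.collapse)
  have T': "?j (?i z) = z" "?i z \<in> ?S" if "z \<in> ?T" for z
    using T[of "fst z" "fst (snd z)" "fst (snd (snd z))" "snd (snd (snd z))"] that
    by (simp_all only: prod.collapse)
  let ?f = "\<lambda>c. if odd c then int c else - int c"
  have "fps_nth (Abs_fps alt_divisor_sum * odd_divisor_series) n =
      (\<Sum>k=0..n. (\<Sum>c | c \<in> {1..k} \<and> c dvd k. ?f c) * (\<Sum>z\<in>factor_pairs (2 * int (n - k) + 1). snd z))"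
    by (simp add: fps_mult_nth alt_divisor_sum_def odd_divisor_series_def case_prod_unfold)
  also have "\<dots> = (\<Sum>k=0..n. \<Sum>(c, z)\<in>{c \<in> {1..k}. c dvd k} \<times> factor_pairs (2 * int (n - k) + 1). ?f c * snd z)"
    by (simp add: sum_product sum.cartesian_product)
  also have "\<dots> = (\<Sum>(k, c, z)\<in>?S. ?f c * snd z)"
    by (subst sum.Sigma) (auto simp: finite_factor_pairs)
  also have "\<dots> = (\<Sum>(a, b, c, d)\<in>?T. if odd c then a * c else - a * c)"
    by (rule sum.reindex_bij_witness[of _ ?i ?j, OF S' T']) auto
  finally show ?thesis .
qed

lemma fps_X_deriv_odd_divisor_series:
  "fps_X * fps_deriv odd_divisor_series = 4 * odd_divisor_series * Abs_fps alt_divisor_sum"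
proof (rule fps_ext)
  fix n
  have "8 * fps_nth (Abs_fps alt_divisor_sum * odd_divisor_series) n = 2 * int n * fps_nth odd_divisor_series n"
    unfolding alt_divisor_sum_mult_odd_divisor_series
    by (subst quads_weighted_sum) (auto simp: odd_divisor_series_def)
  moreover have "fps_nth (fps_X * fps_deriv odd_divisor_series) n = int n * fps_nth odd_divisor_series n"
    by (cases n) auto
  moreover have "fps_nth (4 * odd_divisor_series * Abs_fps alt_divisor_sum) n =
      4 * fps_nth (Abs_fps alt_divisor_sum * odd_divisor_series) n"
    by (metis (no_types, opaque_lifting) fps_mult_left_const_nth mult.assoc mult.commute numeral_fps_const)
  ultimately show "fps_nth (fps_X * fps_deriv odd_divisor_series) n =
      fps_nth (4 * odd_divisor_series * Abs_fps alt_divisor_sum) n" by simp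
qed

text \<open>As \<open>L\<close> has no constant term, comparing coefficients gives a recursion:
  \<open>n\<close> times the \<open>n\<close>-th coefficient is determined by the earlier
  ones.\<close>

lemma fps_log_deriv_unique:
  fixes A B L :: "int fps"
  assumes "fps_X * fps_deriv A = A * L" "fps_X * fps_deriv B = B * L"
    and "fps_nth L 0 = 0" "fps_nth A 0 = fps_nth B 0"
  shows "A = B"
proof (rule fps_ext)
  fix n
  show "fps_nth A n = fps_nth B n"
  proof (induction n rule: less_induct)
    case (less n)
    have coeff: "int n * fps_nth F n = (\<Sum>i=0..<n. fps_nth F i * fps_nth L (n - i))"
      if "fps_X * fps_deriv F = F * L" for F
    proof -
      have "int n * fps_nth F n = fps_nth (fps_X * fps_deriv F) n" by (cases n) auto
      also have "\<dots> = (\<Sum>i=0..n. fps_nth F i * fps_nth L (n - i))"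
        unfolding that by (simp add: fps_mult_nth)
      also have "\<dots> = (\<Sum>i=0..<n. fps_nth F i * fps_nth L (n - i))"
        using assms(3) by (simp add: sum.last_plus)
      finally show ?thesis .
    qed
    have "int n * fps_nth A n = int n * fps_nth B n"
      unfolding coeff[OF assms(1)] coeff[OF assms(2)] using less by (intro sum.cong) auto
    then show ?case using assms(4) by (cases "n = 0") auto
  qed
qed

lemma triangle_series_power4: "triangle_series ^ 4 = odd_divisor_series"
proof (rule fps_log_deriv_unique)
  have "fps_X * fps_deriv (triangle_series ^ 4) = 4 * triangle_series ^ 3 * (fps_X * fps_deriv triangle_series)"
    by (simp add: fps_deriv_power eval_nat_numeral algebra_simps)
  then show "fps_X * fps_deriv (triangle_series ^ 4) = triangle_series ^ 4 * (4 * Abs_fps alt_divisor_sum)"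
    unfolding fps_X_deriv_triangle_series by (simp add: eval_nat_numeral algebra_simps)
  show "fps_X * fps_deriv odd_divisor_series = odd_divisor_series * (4 * Abs_fps alt_divisor_sum)"
    unfolding fps_X_deriv_odd_divisor_series by (simp add: algebra_simps)
  show "fps_nth (4 * Abs_fps alt_divisor_sum) 0 = 0"
    by (simp add: alt_divisor_sum_def)
  have "factor_pairs 1 = {(1, 1)}"
    by (auto simp: factor_pairs_def zmult_eq_1_iff)
  moreover have "0 \<in> range triangle" by (metis rangeI triangle_0)
  ultimately show "fps_nth (triangle_series ^ 4) 0 = fps_nth odd_divisor_series 0"
    by (simp add: odd_divisor_series_def triangle_series_def fps_power_zeroth)
qed

section \<open>Counting reduced matrices of given determinant\<close>

text \<open>This and the next four lemmas are the propositional skeletons of the cases in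
  \<open>reduced_crossing\<close>. There \<open>p\<close>, \<open>u\<close>, \<open>v\<close> are
  the three conditions of being reduced at \<open>g = 1\<close>, \<open>D\<close> and
  \<open>H\<close> the positivity of \<open>d\<close> and \<open>h\<close>, \<open>w\<close> the
  comparison of two walls, \<open>T\<close> is \<open>t > 0\<close> and \<open>R\<close> is
  \<open>r < 0\<close>.\<close>

lemma of_bool_crossing1:
  assumes "v \<Longrightarrow> u \<Longrightarrow> w" "\<not> v \<Longrightarrow> w \<Longrightarrow> u" "p \<Longrightarrow> u \<Longrightarrow> D" "\<not> p \<Longrightarrow> D \<Longrightarrow> u" "\<not> p \<Longrightarrow> v"
  shows "(of_bool (p \<and> u \<and> v) :: int) = - of_bool (D \<and> \<not> p) + of_bool (D \<and> u \<and> w) - of_bool (\<not> v \<and> w)"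
  using assms by (cases p; cases u; cases v; cases w; cases D) simp_all

lemma of_bool_crossing2:
  assumes "T \<Longrightarrow> u \<Longrightarrow> \<not> w" "\<not> T \<Longrightarrow> \<not> v \<Longrightarrow> u \<Longrightarrow> \<not> w" "v \<Longrightarrow> \<not> w \<Longrightarrow> u" "H \<Longrightarrow> \<not> T \<Longrightarrow> \<not> D \<Longrightarrow> w"
    "v \<Longrightarrow> \<not> T" "\<not> p \<Longrightarrow> \<not> T" "\<not> v \<Longrightarrow> \<not> p \<Longrightarrow> \<not> H" "p \<Longrightarrow> u \<Longrightarrow> D" "p \<Longrightarrow> v \<Longrightarrow> H" "\<not> p \<Longrightarrow> D \<Longrightarrow> u"
  shows "(of_bool (p \<and> u \<and> v) :: int) = - of_bool (D \<and> H \<and> \<not> p) + of_bool (D \<and> H \<and> u \<and> w) + of_bool (H \<and> v \<and> \<not> w)"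
proof -
  have "(p \<and> u \<and> v \<and> D \<and> H) \<or> (p \<and> \<not> (u \<and> v) \<and> \<not> (u \<and> w) \<and> \<not> (v \<and> \<not> w)) \<or> (\<not> p \<and> H \<and> v \<and> D \<and> u) \<or>
      (\<not> p \<and> H \<and> \<not> D \<and> w) \<or> (\<not> p \<and> \<not> H)"
    using assms by blast
  then show ?thesis by (elim disjE) auto
qed

lemma of_bool_crossing3:
  assumes "p \<Longrightarrow> \<not> D \<Longrightarrow> \<not> w" "u \<Longrightarrow> \<not> v \<Longrightarrow> w" "\<not> u \<Longrightarrow> v \<Longrightarrow> \<not> w" "\<not> p \<Longrightarrow> v" "\<not> p \<Longrightarrow> D \<Longrightarrow> u" "p \<Longrightarrow> \<not> D \<Longrightarrow> \<not> u"
  shows "(of_bool (p \<and> u \<and> v) :: int) = of_bool (D \<and> p) - of_bool (D \<and> \<not> u \<and> \<not> w) - of_bool (\<not> v \<and> w)"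
proof -
  have "(p \<and> D \<and> (u \<and> v \<or> u \<and> \<not> v \<and> w \<or> \<not> u \<and> v \<and> \<not> w \<or> \<not> u \<and> \<not> v)) \<or> (p \<and> \<not> D \<and> \<not> w \<and> \<not> u) \<or> (\<not> p \<and> v \<and> (D \<longrightarrow> u))"
    using assms by blast
  then show ?thesis by (elim disjE) auto
qed

lemma of_bool_crossing4:
  assumes "p \<Longrightarrow> u \<Longrightarrow> D" "\<not> p \<Longrightarrow> D \<Longrightarrow> u" "\<not> p \<Longrightarrow> v"
  shows "(of_bool (p \<and> u \<and> v) :: int) = - of_bool (D \<and> \<not> p) + of_bool (D \<and> u \<and> v)"
  using assms by (cases p; cases u; cases v; cases D) simp_all

lemma of_bool_crossing5:
  assumes "p \<Longrightarrow> u \<Longrightarrow> H" "H \<Longrightarrow> w \<longleftrightarrow> u" "\<not> p \<Longrightarrow> H \<Longrightarrow> u" "R \<Longrightarrow> \<not> H" "p \<Longrightarrow> v \<Longrightarrow> H" "\<not> p \<Longrightarrow> H \<Longrightarrow> v"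
  shows "(of_bool (p \<and> u \<and> v) :: int) - of_bool (H \<and> p \<and> u) = - of_bool (H \<and> \<not> v \<and> w) + of_bool (R \<and> H \<and> v \<and> \<not> w)"
proof (cases H)
  case True
  then have "\<not> R" "w = u" "\<not> p \<Longrightarrow> u \<and> v" using assms by blast+
  then show ?thesis using True by (cases p; cases u; cases v) simp_all
next
  case False
  then have "\<not> (p \<and> u)" using assms by blast
  then show ?thesis using False by auto
qed

text \<open>
  Scale the second column of the matrix with rows \<open>(d, q)\<close>, \<open>(t, h)\<close> by a real \<open>g \<ge> 1\<close>. It is
  reduced if \<open>t + g q\<close>, \<open>2 g h - t - g q\<close> and \<open>2 d - t - g q\<close> are all positive. Being reduced at \<open>g = 1\<close>
  minus being reduced for all large \<open>g\<close> is the signed number of walls (zeros of one of these functions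
  at which the other two are positive) met for \<open>g > 1\<close>; the six terms on the right are these walls.
  The parity conditions exclude coincidences.
\<close>

lemma reduced_crossing:
  fixes d t q h :: int
  assumes "d * h - q * t > 0" and odd: "odd d" "odd t" "even q" "odd h"
  shows "(of_bool (0 < q + t \<and> q + t < 2 * d \<and> q + t < 2 * h) :: int) - of_bool (q = 0 \<and> h > 0 \<and> 0 < t \<and> t < 2 * d) =
    - of_bool (q > 0 \<and> d > 0 \<and> h > 0 \<and> q + t < 0) + of_bool (q < 0 \<and> d > 0 \<and> h > 0 \<and> q + t > 0)
    + of_bool (q > 0 \<and> d > 0 \<and> h > 0 \<and> q + t < 2 * d \<and> t * h < d * (2 * h - q))
    - of_bool (q < 0 \<and> d > 0 \<and> h > 0 \<and> 2 * d < q + t \<and> d * (2 * h - q) < t * h)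
    - of_bool (q < 2 * h \<and> h > 0 \<and> 2 * h < q + t \<and> t * h < d * (2 * h - q))
    + of_bool (2 * h < q \<and> h > 0 \<and> q + t < 2 * h \<and> d * (2 * h - q) < t * h)"
proof -
  \<comment> \<open>The three functions are \<open>t + g * q\<close>, \<open>g * r - t\<close> and
    \<open>s - g * q\<close>, with zeros \<open>- t / q\<close>, \<open>t / r\<close> and
    \<open>s / q\<close>. Comparing the last two zeros means comparing \<open>t * q\<close> with
    \<open>s * r\<close>.\<close>
  define r s where "r = 2 * h - q" and "s = 2 * d - t"
  have ne: "d \<noteq> 0" "t \<noteq> 0" "h \<noteq> 0" "q + t \<noteq> 0" "q + t \<noteq> 2 * d" "q + t \<noteq> 2 * h" "t * h \<noteq> d * (2 * h - q)"
  proof -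
    have "odd (t * h)" "even (d * (2 * h - q))" using odd by auto
    then show "t * h \<noteq> d * (2 * h - q)" by metis
  qed (use odd in presburger)+
  have "s * r - t * q = 2 * (d * (2 * h - q) - t * h)"
    by (simp add: r_def s_def algebra_simps)
  moreover have iff: "(x < y \<longleftrightarrow> z < w)" if "w - z = 2 * (y - x)" for x y z w :: int
    using that by arith
  ultimately have Y: "t * h < d * (2 * h - q) \<longleftrightarrow> t * q < s * r" "d * (2 * h - q) < t * h \<longleftrightarrow> s * r < t * q"
    by (auto intro!: iff simp: algebra_simps)
  have s_iff: "q + t < 2 * d \<longleftrightarrow> q < s" "2 * d < q + t \<longleftrightarrow> s < q" by (auto simp: s_def)
  have r_iff: "q + t < 2 * h \<longleftrightarrow> t < r" "2 * h < q + t \<longleftrightarrow> r < t" "q < 2 * h \<longleftrightarrow> 0 < r" "2 * h < q \<longleftrightarrow> r < 0" by (auto simp: r_def)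
  define A B where "A = t * h" and "B = d * (2 * h - q)"
  have Y: "A < B \<longleftrightarrow> t * q < s * r" "B < A \<longleftrightarrow> s * r < t * q"
    using Y by (simp_all add: A_def B_def)
  have AB: "A \<noteq> B" using ne by (simp add: A_def B_def)
  define p u v w D H where "p = (0 < q + t)" and "u = (q + t < 2 * d)" and "v = (q + t < 2 * h)"
    and "w = (A < B)" and "D = (d > 0)" and "H = (h > 0)"
  note bools = p_def[symmetric] u_def[symmetric] v_def[symmetric] w_def[symmetric] D_def[symmetric] H_def[symmetric]
  have rel: "p \<Longrightarrow> u \<Longrightarrow> D" "p \<Longrightarrow> v \<Longrightarrow> H" "\<not> p \<Longrightarrow> D \<Longrightarrow> u" "\<not> p \<Longrightarrow> H \<Longrightarrow> v"
    unfolding p_def u_def v_def D_def H_def by linarith+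
  have eqs: "q + t < 0 \<longleftrightarrow> \<not> p" "2 * d < q + t \<longleftrightarrow> \<not> u" "2 * h < q + t \<longleftrightarrow> \<not> v" "B < A \<longleftrightarrow> \<not> w"
    unfolding p_def u_def v_def w_def using ne AB by linarith+
  have st: "q < s \<longleftrightarrow> u" "t < r \<longleftrightarrow> v" "s < q \<longleftrightarrow> \<not> u" "r < t \<longleftrightarrow> \<not> v"
    using eqs s_iff r_iff by (simp_all add: bools)
  have qr: "q < 2 * h \<longleftrightarrow> r > 0" "2 * h < q \<longleftrightarrow> r < 0" by (simp_all add: r_def)
  \<comment> \<open>The signs of \<open>q\<close> and \<open>r\<close> give the slopes of the
    functions in \<open>g\<close>, hence which walls can be met as \<open>g\<close> grows from
    1.\<close>
  consider "q > 0" "r > 0" | "q > 0" "r < 0" | "q > 0" "r = 0" | "q < 0" "h < 0" | "q < 0" "h > 0" | "q = 0"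
    using linorder_less_linear[of q 0] linorder_less_linear[of r 0] linorder_less_linear[of h 0] ne(3) by blast
  then show ?thesis
  proof cases
    case 1
    have a: "A < B" if "t < r" "q < s"
    proof (cases "t > 0")
      case True
      then show ?thesis unfolding Y using that 1 by (simp add: mult.commute[of s] mult_strict_mono)
    next
      case False
      then have "t * q \<le> 0" "0 < s * r" using 1 that by (simp_all add: mult_nonpos_nonneg)
      then show ?thesis unfolding Y by linarith
    qed
    have b: "q < s" if "r < t" "A < B"
    proof -
      have "q * r < q * t" using that 1 by simp
      then have "q * r < s * r" using that unfolding Y by (simp add: mult.commute)
      then show ?thesis using 1 by simp
    qed
    have H: H unfolding H_def using 1 r_def by linarith
    have "(of_bool (p \<and> u \<and> v) :: int) = - of_bool (D \<and> \<not> p) + of_bool (D \<and> u \<and> w) - of_bool (\<not> v \<and> w)"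
      by (rule of_bool_crossing1) (use a b H rel in \<open>unfold st bools, blast+\<close>)
    moreover have "q \<noteq> 0" "\<not> q < 0" "\<not> r < 0" using 1 by auto
    ultimately show ?thesis
      unfolding A_def[symmetric] B_def[symmetric] eqs bools qr using 1 H by simp
  next
    case 2
    have a: "\<not> A < B" if "t > 0" "q < s"
    proof -
      have "s * r < 0" using 2 that by (simp add: mult_pos_neg)
      moreover have "t * q > 0" using 2 that by simp
      ultimately show ?thesis unfolding Y by linarith
    qed
    have b: "B < A" if "t < 0" "r < t" "q < s"
    proof -
      have "s * r < s * t" using 2 that by simp
      also have "s * t < q * t" using that by (simp add: mult_less_cancel_right)
      finally show ?thesis unfolding Y by (simp add: mult.commute)
    qed
    have c: "q < s" if "t < r" "B < A"
    proof -
      have "q * t < q * r" using that 2 by simp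
      then have "s * r < q * r" using that unfolding Y by (simp add: mult.commute)
      then show ?thesis using 2 by (simp add: mult_less_cancel_right)
    qed
    have d: "\<not> B < A" if "h > 0" "t < 0" "d < 0"
    proof -
      have "A < 0" unfolding A_def using that by (simp add: mult_neg_pos)
      moreover have "B > 0" unfolding B_def using that 2 by (simp add: r_def mult_neg_neg)
      ultimately show ?thesis by linarith
    qed
    have e: "t < 0 \<longleftrightarrow> \<not> 0 < t" using ne(2) by linarith
    have f: "v \<Longrightarrow> t < 0" "\<not> p \<Longrightarrow> t < 0" "\<not> v \<Longrightarrow> \<not> p \<Longrightarrow> \<not> H"
      using 2 ne(2,4) unfolding v_def p_def r_def H_def by linarith+
    have g: "\<not> D \<Longrightarrow> d < 0" using ne(1) unfolding D_def by linarith
    have "(of_bool (p \<and> u \<and> v) :: int) = - of_bool (D \<and> H \<and> \<not> p) + of_bool (D \<and> H \<and> u \<and> w) + of_bool (H \<and> v \<and> \<not> w)"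
      by (rule of_bool_crossing2[where T = "t > 0"]) (use a b c d f g rel in \<open>unfold st bools eqs e, blast+\<close>)
    moreover have "q \<noteq> 0" "\<not> q < 0" "\<not> r > 0" using 2 by auto
    ultimately show ?thesis
      unfolding A_def[symmetric] B_def[symmetric] eqs bools qr using 2 by simp
  next
    case 3
    then have q: "q = 2 * h" "h > 0" by (auto simp: r_def)
    have "A < B \<longleftrightarrow> t < 0" "B < A \<longleftrightarrow> t > 0"
      unfolding A_def B_def using q by (simp_all add: mult_less_0_iff zero_less_mult_iff)
    then have *: "w \<longleftrightarrow> t < 0" by (simp add: w_def)
    have **: "t < 0 \<longleftrightarrow> v" "\<not> p \<Longrightarrow> v" H
      using q ne(2,4,6) unfolding v_def p_def H_def by linarith+
    have "(of_bool (p \<and> u \<and> v) :: int) = - of_bool (D \<and> \<not> p) + of_bool (D \<and> u \<and> v)"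
      by (rule of_bool_crossing4) (use rel ** in blast)+
    moreover have "q \<noteq> 0" "\<not> q < 0" using 3 by auto
    ultimately show ?thesis
      unfolding A_def[symmetric] B_def[symmetric] eqs bools qr using 3 * ** by simp
  next
    case 4
    then have "\<not> (p \<and> v)" "\<not> H" unfolding p_def v_def H_def by linarith+
    then show ?thesis
      unfolding A_def[symmetric] B_def[symmetric] eqs bools qr using 4 by simp
  next
    case 5
    then have r: "r > 0" by (simp add: r_def)
    have a: "\<not> A < B" if "t > 0" "d < 0"
    proof -
      have "A > 0" unfolding A_def using that 5 by simp
      moreover have "B < 0" unfolding B_def using that r by (simp add: r_def mult_neg_pos)
      ultimately show ?thesis by linarith
    qed
    have b: "A < B" if "q < s" "r < t"
    proof -
      have "t * q < r * q" using that 5 by (simp add: mult_less_cancel_right)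
      also have "\<dots> < r * s" using that r by simp
      finally show ?thesis unfolding Y by (simp add: mult.commute)
    qed
    have c: "B < A" if "s < q" "t < r"
    proof -
      have "r * s < r * q" using that r by simp
      also have "\<dots> < t * q" using that 5 by (simp add: mult_less_cancel_right)
      finally show ?thesis unfolding Y by (simp add: mult.commute)
    qed
    have e: "p \<Longrightarrow> t > 0" "\<not> D \<Longrightarrow> d < 0" "H" "\<not> p \<Longrightarrow> v"
      using 5 ne(1) unfolding p_def D_def H_def v_def by linarith+
    have f: "\<not> p \<Longrightarrow> D \<Longrightarrow> u" "p \<Longrightarrow> \<not> D \<Longrightarrow> \<not> u"
      using 5 ne(1) unfolding p_def D_def u_def by linarith+
    have "(of_bool (p \<and> u \<and> v) :: int) = of_bool (D \<and> p) - of_bool (D \<and> \<not> u \<and> \<not> w) - of_bool (\<not> v \<and> w)"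
      by (rule of_bool_crossing3) (use a b c e f in \<open>unfold st bools eqs, blast+\<close>)
    moreover have "q \<noteq> 0" "\<not> q > 0" "\<not> r < 0" using 5 r by auto
    ultimately show ?thesis
      unfolding A_def[symmetric] B_def[symmetric] eqs bools qr using 5 r e(3) by simp
  next
    case 6
    then have "d * h > 0" using assms by simp
    then have "d > 0 \<longleftrightarrow> h > 0" by (auto simp: zero_less_mult_iff)
    moreover have "A < B \<longleftrightarrow> t < 2 * d" if "h > 0"
      unfolding A_def B_def using that 6 by (metis diff_zero mult.assoc mult.commute mult_less_cancel_right_pos)
    ultimately have *: "D \<longleftrightarrow> H" "H \<Longrightarrow> w \<longleftrightarrow> t < 2 * d"
      by (simp_all add: D_def H_def w_def)
    have **: "t < 2 * d \<longleftrightarrow> u" "0 < t \<longleftrightarrow> p" "r > 0 \<longleftrightarrow> H" "\<not> r < 0 \<or> \<not> H" unfolding u_def p_def H_def r_def using 6 by simp_all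
    have "(of_bool (p \<and> u \<and> v) :: int) - of_bool (H \<and> p \<and> u) = - of_bool (H \<and> \<not> v \<and> w) + of_bool (r < 0 \<and> H \<and> v \<and> \<not> w)"
      by (rule of_bool_crossing5) (use * ** rel in blast)+
    then show ?thesis
      unfolding A_def[symmetric] B_def[symmetric] eqs bools qr using 6 ** by simp
  qed
qed

text \<open>The tuple lists the matrix with rows \<open>(d, q)\<close> and \<open>(t, h)\<close>
  column by column. Adding an even multiple of one row to the other preserves the parity
  class.\<close>

definition mats :: "int \<Rightarrow> (int \<times> int \<times> int \<times> int) set" where
  "mats P = {(d, t, q, h). d * h - q * t = P \<and> odd d \<and> odd t \<and> even q \<and> odd h}"

definition reduced_mats :: "int \<Rightarrow> (int \<times> int \<times> int \<times> int) set" where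
  "reduced_mats P = {(d, t, q, h) \<in> mats P. 0 < q + t \<and> q + t < 2 * d \<and> q + t < 2 * h}"

text \<open>These are the matrices in \<open>mats P\<close> that are reduced for all large
  \<open>g\<close>: bounds on \<open>t + g * q\<close> from both sides force
  \<open>q = 0\<close>.\<close>

definition triangular_mats :: "int \<Rightarrow> (int \<times> int \<times> int \<times> int) set" where
  "triangular_mats P = {(d, t, q, h) \<in> mats P. q = 0 \<and> h > 0 \<and> 0 < t \<and> t < 2 * d}"

text \<open>
  In \<open>wall12\<close>, \<open>wall13\<close>, \<open>wall23\<close> the function \<open>t + g q\<close>, \<open>2 d - t - g q\<close>, \<open>2 g h - t - g q\<close>
  respectively vanishes at some \<open>g > 1\<close>, the other two being positive there; the suffixes \<open>p\<close>, \<open>n\<close>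
  give the sign of the coefficient \<open>q\<close> (for \<open>wall23\<close>: of \<open>2 * h - q\<close>).
\<close>

definition wall12p :: "int \<Rightarrow> (int \<times> int \<times> int \<times> int) set" where
  "wall12p P = {(d, t, q, h) \<in> mats P. q > 0 \<and> d > 0 \<and> h > 0 \<and> q + t < 0}"

definition wall12n :: "int \<Rightarrow> (int \<times> int \<times> int \<times> int) set" where
  "wall12n P = {(d, t, q, h) \<in> mats P. q < 0 \<and> d > 0 \<and> h > 0 \<and> q + t > 0}"

definition wall13p :: "int \<Rightarrow> (int \<times> int \<times> int \<times> int) set" where
  "wall13p P = {(d, t, q, h) \<in> mats P. q > 0 \<and> d > 0 \<and> h > 0 \<and> q + t < 2 * d \<and> t * h < d * (2 * h - q)}"

definition wall13n :: "int \<Rightarrow> (int \<times> int \<times> int \<times> int) set" where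
  "wall13n P = {(d, t, q, h) \<in> mats P. q < 0 \<and> d > 0 \<and> h > 0 \<and> 2 * d < q + t \<and> d * (2 * h - q) < t * h}"

definition wall23p :: "int \<Rightarrow> (int \<times> int \<times> int \<times> int) set" where
  "wall23p P = {(d, t, q, h) \<in> mats P. q < 2 * h \<and> h > 0 \<and> 2 * h < q + t \<and> t * h < d * (2 * h - q)}"

definition wall23n :: "int \<Rightarrow> (int \<times> int \<times> int \<times> int) set" where
  "wall23n P = {(d, t, q, h) \<in> mats P. 2 * h < q \<and> h > 0 \<and> q + t < 2 * h \<and> d * (2 * h - q) < t * h}"

lemmas wall_defs = wall12p_def wall12n_def wall13p_def wall13n_def wall23p_def wall23n_def mats_def

section \<open>Pairing the walls by row operations\<close>

lemma bij_betw_quads: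
  assumes "\<And>a b c d. (a, b, c, d) \<in> A \<Longrightarrow> f (a, b, c, d) \<in> B \<and> g (f (a, b, c, d)) = (a, b, c, d)"
    "\<And>a b c d. (a, b, c, d) \<in> B \<Longrightarrow> g (a, b, c, d) \<in> A \<and> f (g (a, b, c, d)) = (a, b, c, d)"
  shows "bij_betw f A B"
  by (rule bij_betw_byWitness[of _ g]) (use assms in auto)

text \<open>Here \<open>q\<close> and \<open>t\<close> have opposite signs, so the determinant is a
  sum of two positive products and \<open>quads\<close> bounds the entries.\<close>

lemma finite_wall12: "finite (wall12p P)" "finite (wall12n P)"
proof -
  have "z \<in> (\<lambda>(a, b, c, d). (a, - c, d, b)) ` quads P" if "z \<in> wall12p P" for z
  proof -
    obtain d t q h where z: "z = (d, t, q, h)" by (cases z)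
    then have "(d, h, - t, q) \<in> quads P" using that by (simp add: wall_defs quads_def mult.commute)
    then show ?thesis unfolding z by (rule rev_image_eqI) simp
  qed
  then show "finite (wall12p P)" by (intro finite_surj[OF finite_quads] subsetI)
  have "z \<in> (\<lambda>(a, b, c, d). (a, c, - d, b)) ` quads P" if "z \<in> wall12n P" for z
  proof -
    obtain d t q h where z: "z = (d, t, q, h)" by (cases z)
    then have "(d, h, t, - q) \<in> quads P" using that by (simp add: wall_defs quads_def mult.commute)
    then show ?thesis unfolding z by (rule rev_image_eqI) simp
  qed
  then show "finite (wall12n P)" by (intro finite_surj[OF finite_quads] subsetI)
qed

lemma mult_pos_cancel_left: "(0 :: int) < a * b \<Longrightarrow> 0 < a \<Longrightarrow> 0 < b"
  by (simp add: zero_less_mult_iff)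

text \<open>
  At each wall exactly one row operation by an even multiple leads to a matrix in the same lattice for
  which the same \<open>g\<close> is a wall of opposite sign. Thus the walls cancel in pairs.
\<close>

lemma wall12p_wall13p:
  "bij_betw (\<lambda>(d, t, q, h). (d, t + 2 * d, q, h + 2 * q))
     {(d, t, q, h) \<in> wall12p P. d * q < - t * (h + 2 * q)} {(d, t, q, h) \<in> wall13p P. 2 * q < h}"
  by (rule bij_betw_quads[where g = "\<lambda>(d, t, q, h). (d, t - 2 * d, q, h - 2 * q)"])
     (auto simp: wall_defs algebra_simps)

lemma wall12n_wall13n:
  "bij_betw (\<lambda>(d, t, q, h). (d, t + 2 * d, q, h + 2 * q))
     {(d, t, q, h) \<in> wall12n P. \<not> d * q < - t * (h + 2 * q)} (wall13n P)"
proof (rule bij_betw_quads[where g = "\<lambda>(d, t, q, h). (d, t - 2 * d, q, h - 2 * q)"], goal_cases)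
  case (1 d t q h)
  then have *: "(d, t, q, h) \<in> wall12n P" "- t * (h + 2 * q) \<le> d * q" by auto
  \<comment> \<open>At the wall \<open>g = - t / q\<close> the case condition reads
    \<open>d \<le> g * (h + 2 * q)\<close>, and parity excludes equality. The strict inequality
    makes the third function positive after twice the first row is added to the second.\<close>
  have "odd (t * (h + 2 * q))" "even (d * q)" using * by (auto simp: wall_defs)
  then have "- t * (h + 2 * q) \<noteq> d * q" by (metis even_minus mult_minus_left)
  then have lt: "- t * (h + 2 * q) < d * q" using * by linarith
  have "d * q < 0" "0 < t" using * by (auto simp: wall_defs mult_pos_neg)
  then have "0 < t * (h + 2 * q)" using lt by simp
  then have "0 < h + 2 * q" using \<open>0 < t\<close> by (rule mult_pos_cancel_left)
  then show ?case using * lt by (auto simp: wall_defs algebra_simps)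
next
  case (2 d t q h)
  then show ?case by (auto simp: wall_defs algebra_simps)
qed

lemma wall12p_wall23n:
  "bij_betw (\<lambda>(d, t, q, h). (d + 2 * t, t, q + 2 * h, h))
     {(d, t, q, h) \<in> wall12p P. \<not> d * q < - t * (h + 2 * q)} (wall23n P)"
proof (rule bij_betw_quads[where g = "\<lambda>(d, t, q, h). (d - 2 * t, t, q - 2 * h, h)"], goal_cases)
  case (1 d t q h)
  then have *: "(d, t, q, h) \<in> wall12p P" "- t * (h + 2 * q) \<le> d * q" by auto
  have "odd (t * (h + 2 * q))" "even (d * q)" using * by (auto simp: wall_defs)
  then have "- t * (h + 2 * q) \<noteq> d * q" by (metis even_minus mult_minus_left)
  then have lt: "- t * (h + 2 * q) < d * q" using * by linarith
  then show ?case using * lt by (auto simp: wall_defs algebra_simps)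
next
  case (2 d t q h)
  then have *: "2 * h - q < 0" "t < 0" "h > 0" "d * (2 * h - q) < t * h" by (auto simp: wall_defs)
  then have "t * h < 0" by (simp add: mult_neg_pos)
  then have "d * (2 * h - q) < 0" using * by linarith
  then have "d > 0" using * by (simp add: mult_less_0_iff)
  then show ?case using 2 * by (auto simp: wall_defs algebra_simps)
qed

lemma wall12n_wall23p:
  "bij_betw (\<lambda>(d, t, q, h). (d + 2 * t, t, q + 2 * h, h))
     {(d, t, q, h) \<in> wall12n P. d * q < - t * (h + 2 * q)} {(d, t, q, h) \<in> wall23p P. 2 * t < d}"
  by (rule bij_betw_quads[where g = "\<lambda>(d, t, q, h). (d - 2 * t, t, q - 2 * h, h)"])
     (auto simp: wall_defs algebra_simps)

section \<open>The infinite families of walls and their truncation\<close>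

lemma wall_iff:
  fixes d :: int shows "t * h < d * (2 * h - q) \<longleftrightarrow> (t - d) * (h - q) < d * h - q * t"
  by (auto simp: algebra_simps)

text \<open>
  The pairing of \<open>wall13p\<close> with \<open>wall23p\<close> involves infinite sets: the walls accumulate at
  \<open>g = (t - d) / (h - q)\<close> when \<open>0 < (t - d) * (h - q) < P\<close> and this ratio exceeds 1. These families
  are cut off, and the elements of \<open>cusp_mats\<close> account for both ends of the cut.
\<close>

definition trunc13 :: "int \<Rightarrow> int \<Rightarrow> (int \<times> int \<times> int \<times> int) set" where
  "trunc13 P c = {(d, t, q, h) \<in> wall13p P. h < 2 * q \<and> \<not> (0 < h - q \<and> h - q < t - d) \<and>
    (t - d < h - q \<and> h - q < 0 \<longrightarrow> q < c * (q - h))}"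

definition trunc23 :: "int \<Rightarrow> int \<Rightarrow> (int \<times> int \<times> int \<times> int) set" where
  "trunc23 P c = {(d, t, q, h) \<in> wall23p P. d < 2 * t \<and> \<not> (0 < h - q \<and> h - q < t - d) \<and>
    (t - d < h - q \<and> h - q < 0 \<longrightarrow> q < c * (q - h))}"

text \<open>The move adds twice the row difference \<open>(d - t, q - h)\<close> to both rows. It
  preserves this difference, and with it the wall inequality in the shape of
  \<open>wall_iff\<close>, while \<open>q\<close> grows by \<open>2 * (q - h)\<close>; hence the cut
  \<open>c\<close> becomes \<open>c + 2\<close>.\<close>

lemma trunc13_trunc23:
  "bij_betw (\<lambda>(d, t, q, h). (3 * d - 2 * t, 2 * d - t, 3 * q - 2 * h, 2 * q - h)) (trunc13 P c) (trunc23 P (c + 2))"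
proof (rule bij_betw_quads[where g = "\<lambda>(d, t, q, h). (2 * t - d, 3 * t - 2 * d, 2 * h - q, 3 * h - 2 * q)"], goal_cases)
  case (1 d t q h)
  then show ?case by (auto simp: trunc13_def trunc23_def wall_defs algebra_simps)
next
  case (2 d t q h)
  then have *: "q < 2 * h" "2 * h < q + t" "t * h < d * (2 * h - q)" "d < 2 * t"
    by (auto simp: trunc23_def wall_defs)
  have "0 < (2 * t - d) * (2 * h - q)" using * by simp
  also have "(2 * t - d) * (2 * h - q) < (t) * (3 * h - 2 * q)"
    using * by (simp add: algebra_simps)
  finally have "0 < t * (3 * h - 2 * q)" .
  moreover have "t > 0" using * by linarith
  ultimately have "0 < 3 * h - 2 * q" by (rule mult_pos_cancel_left)
  then show ?case using 2 by (auto simp: trunc13_def trunc23_def wall_defs algebra_simps)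
qed

text \<open>On the family \<open>0 < h - q < t - d\<close> with product below \<open>P\<close>, the
  part \<open>h < 2 * q\<close> of \<open>wall13p\<close> is given by \<open>h - q < q\<close>, and
  the part \<open>d < 2 * t\<close> of \<open>wall23p\<close> by \<open>- (h - q) < q\<close>. This
  set is their difference, \<open>q = h - q\<close> being impossible by parity.\<close>

definition cusp_mats :: "int \<Rightarrow> (int \<times> int \<times> int \<times> int) set" where
  "cusp_mats P = {(d, t, q, h) \<in> mats P. 0 < h - q \<and> h - q < t - d \<and> (t - d) * (h - q) < P \<and>
     - (h - q) < q \<and> q < h - q}"

lemma trunc13_diff:
  "trunc13 P (2 * P + 1) - trunc13 P (2 * P - 1) = {(d, t, q, h) \<in> wall13p P. h < 2 * q \<and>
     t - d < h - q \<and> h - q < 0 \<and> (2 * P - 1) * (q - h) \<le> q \<and> q < (2 * P + 1) * (q - h)}"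
  by (auto simp: trunc13_def)

text \<open>Each row is negated and \<open>2 * P\<close> times the row difference is added. The sign
  change leads to the family \<open>t - d < h - q < 0\<close>, and the shift carries the range of
  \<open>q\<close> to the strip between the two cuts.\<close>

lemma cusp_mats_bij:
  assumes "P > 0"
  shows "bij_betw (\<lambda>(d, t, q, h). (2 * P * (t - d) - d, 2 * P * (t - d) - t, 2 * P * (h - q) - q, 2 * P * (h - q) - h))
     (cusp_mats P) (trunc13 P (2 * P + 1) - trunc13 P (2 * P - 1))"
  unfolding trunc13_diff
proof (rule bij_betw_quads[where g = "\<lambda>(d, t, q, h). (2 * P * (d - t) - d, 2 * P * (d - t) - t,
        2 * P * (q - h) - q, 2 * P * (q - h) - h)"], goal_cases)
  case (1 d t q h)
  define \<alpha> \<beta> where "\<alpha> = t - d" and "\<beta> = h - q"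
  have *: "d * h - q * t = P" "odd d" "odd t" "even q" "odd h" "0 < \<beta>" "\<beta> < \<alpha>" "\<alpha> * \<beta> < P" "- \<beta> < q" "q < \<beta>"
    using 1 by (auto simp: cusp_mats_def mats_def \<alpha>_def \<beta>_def)
  have th: "t = d + \<alpha>" "h = q + \<beta>" by (auto simp: \<alpha>_def \<beta>_def)
  have det: "d * \<beta> - q * \<alpha> = P" using *(1) unfolding th by (simp add: algebra_simps)
  have "\<alpha> * q < \<alpha> * \<beta>" "\<alpha> * (- \<beta>) < \<alpha> * q" using * by (intro mult_strict_left_mono; simp)+
  then have "0 < d * \<beta>" "d * \<beta> < 2 * P"
    using det *(8) unfolding mult.commute[of q] mult_minus_right by linarith+
  then have "d > 0" using * by (simp add: zero_less_mult_iff)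
  then have "d * 1 \<le> d * \<beta>" using * by (intro mult_left_mono) auto
  then have "d < 2 * P" using \<open>d * \<beta> < 2 * P\<close> by simp
  \<comment> \<open>These estimates show that the shift by \<open>2 * P\<close> outweighs the
    original entries, which yields all sign conditions of \<open>wall13p\<close>.\<close>
  have "P * 1 \<le> P * (\<alpha> - \<beta>)" "1 * \<beta> \<le> P * \<beta>" "P * 1 \<le> P * \<beta>"
    using * assms by (intro mult_left_mono mult_right_mono; simp)+
  then have big: "P \<le> P * \<alpha> - P * \<beta>" "\<beta> \<le> P * \<beta>" "P \<le> P * \<beta>" by (simp_all add: algebra_simps)
  have "(2 * P * \<alpha> - d, 2 * P * \<alpha> - t, 2 * P * \<beta> - q, 2 * P * \<beta> - h) \<in> mats P"
    using * th by (simp add: mats_def algebra_simps)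
  moreover have "0 < 2 * P * \<beta> - q" "0 < 2 * P * \<alpha> - d" "0 < 2 * P * \<beta> - h"
    "2 * P * \<beta> - h < 2 * (2 * P * \<beta> - q)"
    "2 * P * \<beta> - q + (2 * P * \<alpha> - t) < 2 * (2 * P * \<alpha> - d)"
  proof -
    define X Z where "X = P * \<beta>" and "Z = P * \<alpha>"
    have "2 * P * \<beta> = 2 * X" "2 * P * \<alpha> = 2 * Z" "P \<le> Z - X" "\<beta> \<le> X" "P \<le> X" using big by (auto simp: X_def Z_def)
    then show "0 < 2 * P * \<beta> - q" "0 < 2 * P * \<alpha> - d" "0 < 2 * P * \<beta> - h"
        "2 * P * \<beta> - h < 2 * (2 * P * \<beta> - q)"
        "2 * P * \<beta> - q + (2 * P * \<alpha> - t) < 2 * (2 * P * \<alpha> - d)"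
      using *(6,7,9,10) th \<open>d < 2 * P\<close> \<open>d > 0\<close> by simp_all
  qed
  moreover have "(2 * P * \<alpha> - t) * (2 * P * \<beta> - h) < (2 * P * \<alpha> - d) * (2 * (2 * P * \<beta> - h) - (2 * P * \<beta> - q))"
  proof -
    have "(2 * P * \<alpha> - d) * (2 * (2 * P * \<beta> - h) - (2 * P * \<beta> - q)) - (2 * P * \<alpha> - t) * (2 * P * \<beta> - h) =
       (d * \<beta> - q * \<alpha>) - \<alpha> * \<beta>"
      unfolding th by (simp add: algebra_simps)
    then show ?thesis using det * by simp
  qed
  moreover have "(2 * P - 1) * \<beta> \<le> 2 * P * \<beta> - q" "2 * P * \<beta> - q < (2 * P + 1) * \<beta>"
    using * by (simp_all add: algebra_simps)
  ultimately have "(2 * P * \<alpha> - d, 2 * P * \<alpha> - t, 2 * P * \<beta> - q, 2 * P * \<beta> - h) \<in>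
      {(d, t, q, h) \<in> wall13p P. h < 2 * q \<and> t - d < h - q \<and> h - q < 0 \<and>
        (2 * P - 1) * (q - h) \<le> q \<and> q < (2 * P + 1) * (q - h)}"
    using * th by (simp add: wall13p_def)
  then show ?case unfolding \<alpha>_def \<beta>_def by simp
next
  case (2 d t q h)
  define a b where "a = d - t" and "b = q - h"
  have th: "t = d - a" "h = q - b" by (auto simp: a_def b_def)
  have *: "d * h - q * t = P" "odd d" "odd t" "even q" "odd h" "0 < b" "b < a"
    "t * h < d * (2 * h - q)" "(2 * P - 1) * b \<le> q" "q < (2 * P + 1) * b"
    using 2 by (auto simp: wall13p_def mats_def a_def b_def)
  have det: "q * a - d * b = P" using *(1) unfolding th by (simp add: algebra_simps)
  have ab: "a * b < P"
    using *(8) det unfolding th by (simp add: algebra_simps)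
  have "odd b" using * by (simp add: b_def)
  then have "odd ((2 * P - 1) * b)" by simp
  then have "(2 * P - 1) * b \<noteq> q" using * by metis
  then have "(2 * P - 1) * b < q" using * by linarith
  then have "- b < 2 * P * b - q" "2 * P * b - q < b"
    using * by (simp_all add: algebra_simps)
  moreover have "(2 * P * a - d) * (2 * P * b - h) - (2 * P * b - q) * (2 * P * a - t) = P"
    unfolding det[symmetric] th by (simp add: algebra_simps)
  then have "(2 * P * a - d, 2 * P * a - t, 2 * P * b - q, 2 * P * b - h) \<in> mats P"
    using *(2-5) by (simp add: mats_def)
  ultimately have "(2 * P * a - d, 2 * P * a - t, 2 * P * b - q, 2 * P * b - h) \<in> cusp_mats P"
    using * th ab by (simp add: cusp_mats_def)
  then show ?case unfolding a_def b_def by simp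
qed

text \<open>On the removed family \<open>0 < h - q < t - d\<close> the two walls differ by
  \<open>cusp_mats\<close>. Beyond the cut in the family \<open>t - d < h - q < 0\<close> the two
  conditions are equivalent and cancel. Elsewhere truncation changes nothing.\<close>

lemma trunc13_pointwise:
  assumes "P > 0" and "(d, t, q, h) \<in> mats P"
  shows "(of_bool ((d, t, q, h) \<in> wall13p P \<and> h < 2 * q) :: int) - of_bool ((d, t, q, h) \<in> wall23p P \<and> d < 2 * t) =
    of_bool ((d, t, q, h) \<in> trunc13 P (2 * P + 1)) - of_bool ((d, t, q, h) \<in> trunc23 P (2 * P + 1))
    - of_bool ((d, t, q, h) \<in> cusp_mats P)"
proof -
  define \<alpha> \<beta> where "\<alpha> = t - d" and "\<beta> = h - q"
  have th: "t = d + \<alpha>" "h = q + \<beta>" by (auto simp: \<alpha>_def \<beta>_def)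
  have *: "d * h - q * t = P" "odd d" "odd t" "even q" "odd h"
    using assms(2) by (auto simp: mats_def)
  have det: "d * \<beta> - q * \<alpha> = P" using *(1) unfolding th by (simp add: algebra_simps)
  have Y: "t * h < d * (2 * h - q) \<longleftrightarrow> \<alpha> * \<beta> < P"
    unfolding wall_iff \<alpha>_def \<beta>_def using * by simp
  have w13: "(d, t, q, h) \<in> wall13p P \<and> h < 2 * q \<longleftrightarrow> q > 0 \<and> d > 0 \<and> h > 0 \<and> q + t < 2 * d \<and> \<alpha> * \<beta> < P \<and> h < 2 * q"
    using assms(2) by (auto simp: wall13p_def Y)
  have w23: "(d, t, q, h) \<in> wall23p P \<and> d < 2 * t \<longleftrightarrow> q < 2 * h \<and> h > 0 \<and> 2 * h < q + t \<and> \<alpha> * \<beta> < P \<and> d < 2 * t"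
    using assms(2) by (auto simp: wall23p_def Y)
  consider "0 < \<beta>" "\<beta> < \<alpha>" | "\<alpha> < \<beta>" "\<beta> < 0" "(2 * P + 1) * (- \<beta>) \<le> q"
    | "\<not> (0 < \<beta> \<and> \<beta> < \<alpha>)" "\<not> (\<alpha> < \<beta> \<and> \<beta> < 0 \<and> (2 * P + 1) * (- \<beta>) \<le> q)" by blast
  then show ?thesis
  proof cases
    case 1
    then have trunc: "(d, t, q, h) \<notin> trunc13 P (2 * P + 1)" "(d, t, q, h) \<notin> trunc23 P (2 * P + 1)"
      by (auto simp: trunc13_def trunc23_def \<alpha>_def \<beta>_def)
    have cusp: "(d, t, q, h) \<in> cusp_mats P \<longleftrightarrow> \<alpha> * \<beta> < P \<and> - \<beta> < q \<and> q < \<beta>"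
      using assms(2) 1 by (auto simp: cusp_mats_def \<alpha>_def \<beta>_def)
    have "q \<noteq> \<beta>" using * by (auto simp: \<beta>_def)
    have d_bounds: "d > 0 \<and> q + 2 * \<beta> < d + \<alpha> \<and> d + 2 * \<alpha> > 0" if "\<alpha> * \<beta> < P" "- \<beta> < q"
    proof -
      have "(\<alpha> - \<beta>) * (- \<beta>) < (\<alpha> - \<beta>) * q" using 1 that by (intro mult_strict_left_mono) auto
      moreover have "\<alpha> * (- \<beta>) < \<alpha> * q" using 1 that by (intro mult_strict_left_mono) auto
      moreover have "\<beta> * \<beta> < \<alpha> * \<beta>" using 1 by simp
      ultimately have "0 < \<beta> * d" "0 < \<beta> * (d + \<alpha> - q - 2 * \<beta>)"
        using that det by (simp_all add: algebra_simps)
      then have "d > 0" "d + \<alpha> - q - 2 * \<beta> > 0" using 1 by (simp_all add: zero_less_mult_iff)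
      then show ?thesis using 1 by simp
    qed
    have y: "q + t < 2 * d" if "\<alpha> * \<beta> < P" "\<beta> < q"
    proof -
      have "(\<alpha> - \<beta>) * \<beta> < (\<alpha> - \<beta>) * q" using 1 that by (intro mult_strict_left_mono) auto
      moreover have "\<beta> * \<beta> < \<alpha> * \<beta>" using 1 by simp
      moreover have "0 < q * (\<alpha> - \<beta>)" using 1 that by simp
      ultimately have "0 < \<beta> * (d - q - \<alpha>)" using that det by (simp add: algebra_simps)
      then show ?thesis using 1 th by (simp add: zero_less_mult_iff)
    qed
    have w13': "(d, t, q, h) \<in> wall13p P \<and> h < 2 * q \<longleftrightarrow> \<alpha> * \<beta> < P \<and> \<beta> < q"
    proof -
      have "h < 2 * q \<longleftrightarrow> \<beta> < q" using th by auto
      moreover have "q > 0 \<and> d > 0 \<and> h > 0" if "\<alpha> * \<beta> < P" "\<beta> < q"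
        using d_bounds th 1 that by auto
      ultimately show ?thesis unfolding w13 using y by blast
    qed
    have w23': "(d, t, q, h) \<in> wall23p P \<and> d < 2 * t \<longleftrightarrow> \<alpha> * \<beta> < P \<and> - \<beta> < q"
    proof -
      have "h > 0 \<longleftrightarrow> - \<beta> < q" using th by auto
      moreover have "q < 2 * h \<and> 2 * h < q + t \<and> d < 2 * t" if "\<alpha> * \<beta> < P" "- \<beta> < q"
        using d_bounds[OF that] th 1 that by auto
      ultimately show ?thesis unfolding w23 by blast
    qed
    have "- \<beta> < q" if "\<beta> < q" using 1 that by linarith
    then show ?thesis
      unfolding w13' w23' cusp using trunc \<open>q \<noteq> \<beta>\<close>
      by (cases "\<beta> < q"; cases "- \<beta> < q"; cases "\<alpha> * \<beta> < P") simp_all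
  next
    case 2
    define a b where "a = - \<alpha>" and "b = - \<beta>"
    have \<alpha>: "\<alpha> = - a" "\<beta> = - b" by (auto simp: a_def b_def)
    have ab: "0 < b" "b < a" "(2 * P + 1) * b \<le> q" "q * a - d * b = P" using 2 det unfolding \<alpha> by (auto simp: mult.commute)
    have notin: "(d, t, q, h) \<notin> cusp_mats P" "(d, t, q, h) \<notin> trunc13 P (2 * P + 1)" "(d, t, q, h) \<notin> trunc23 P (2 * P + 1)"
      using 2 by (auto simp: trunc13_def trunc23_def cusp_mats_def \<alpha>_def \<beta>_def)
    \<comment> \<open>Beyond the cut \<open>q\<close> and \<open>d\<close> are so large that every
      remaining condition of both walls holds; only \<open>\<alpha> * \<beta> < P\<close> is left to
      decide.\<close>
    have "q > 0 \<and> d > 0 \<and> h > 0 \<and> q + t < 2 * d \<and> h < 2 * q \<and> q < 2 * h \<and> 2 * h < q + t \<and> d < 2 * t" if "\<alpha> * \<beta> < P"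
    proof -
      have "3 * b \<le> (2 * P + 1) * b" using assms(1) ab by (intro mult_right_mono) auto
      then have q: "3 * b \<le> q" using ab by linarith
      have "((2 * P + 1) * b) * a \<le> q * a" using ab by (intro mult_right_mono) auto
      then have db: "d * b \<ge> (2 * P + 1) * b * a - P" using ab by linarith
      have "P * 1 \<le> P * b" using ab assms(1) by (intro mult_left_mono) auto
      then have "0 \<le> b * (d - ((2 * P + 1) * a - P))" using db by (simp add: algebra_simps)
      then have d: "d \<ge> (2 * P + 1) * a - P" using ab by (simp add: zero_le_mult_iff)
      have "(2 * P - 1) * 2 \<le> (2 * P - 1) * a" using ab assms(1) by (intro mult_left_mono) auto
      then have d2: "d - 2 * a \<ge> 3 * P - 2" using d by (simp add: algebra_simps)
      have "2 * 2 \<le> a * a" using ab by (intro mult_mono) auto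
      moreover have "(d - 2 * a) * 1 \<le> (d - 2 * a) * (a - b)" using ab d2 assms(1) by (intro mult_left_mono) auto
      moreover have "0 < x + y - P" if "4 \<le> y" "d - 2 * a \<le> x" for x y using that d2 assms(1) by linarith
      ultimately have "0 < (d - 2 * a) * (a - b) + a * a - P" by simp
      also have "\<dots> = a * (d + a - q - 2 * (a - b))" using ab(4) by (simp add: algebra_simps)
      finally have "d + a - q - 2 * (a - b) > 0" using ab by (simp add: zero_less_mult_iff)
      then have "q < d + a - 2 * (a - b)" "d > 2 * a" using d2 assms(1) by simp_all
      then show ?thesis using q ab(1,2) unfolding th \<alpha> by simp
    qed
    then have "(d, t, q, h) \<in> wall13p P \<and> h < 2 * q \<longleftrightarrow> (d, t, q, h) \<in> wall23p P \<and> d < 2 * t"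
      unfolding w13 w23 by blast
    then show ?thesis using notin by simp
  next
    case 3
    then have "(d, t, q, h) \<notin> cusp_mats P"
      "(d, t, q, h) \<in> trunc13 P (2 * P + 1) \<longleftrightarrow> (d, t, q, h) \<in> wall13p P \<and> h < 2 * q"
      "(d, t, q, h) \<in> trunc23 P (2 * P + 1) \<longleftrightarrow> (d, t, q, h) \<in> wall23p P \<and> d < 2 * t"
      by (auto simp: trunc13_def trunc23_def cusp_mats_def \<alpha>_def \<beta>_def)
    then show ?thesis by simp
  qed
qed

lemma le_mult_pos:
  fixes x y :: int
  assumes "x > 0" "y > 0"
  shows "x \<le> x * y" "y \<le> x * y"
  using mult_left_mono[of 1 y x] mult_right_mono[of 1 x y] assms by simp_all

text \<open>With \<open>\<alpha> = t - d\<close> and \<open>\<beta> = h - q\<close> one has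
  \<open>d * \<beta> - q * \<alpha> = P\<close> and \<open>\<alpha> * \<beta> < P\<close>. The case
  \<open>0 < \<beta> < \<alpha>\<close> is removed by truncation, and for
  \<open>\<alpha> < \<beta> < 0\<close> the cut bounds \<open>q\<close>. In the other sign cases
  these relations and \<open>q + \<alpha> < d\<close> give bounds or a contradiction.\<close>

lemma trunc13_bounds:
  assumes "P > 0" and "(d, t, q, h) \<in> trunc13 P (2 * P + 1)"
  shows "0 < d" "0 < q" "\<bar>t - d\<bar> \<le> P \<and> \<bar>h - q\<bar> \<le> P \<and> q \<le> (2 * P + 1) * P \<and> d \<le> P + (2 * P + 1) * P * P"
proof -
  define \<alpha> \<beta> where "\<alpha> = t - d" and "\<beta> = h - q"
  have th: "t = d + \<alpha>" "h = q + \<beta>" by (auto simp: \<alpha>_def \<beta>_def)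
  have *: "d * h - q * t = P" "odd d" "odd t" "even q" "odd h" "q > 0" "d > 0" "q + t < 2 * d" "t * h < d * (2 * h - q)"
    "\<not> (0 < \<beta> \<and> \<beta> < \<alpha>)" "\<alpha> < \<beta> \<Longrightarrow> \<beta> < 0 \<Longrightarrow> q < (2 * P + 1) * (- \<beta>)"
    using assms(2) by (auto simp: trunc13_def wall13p_def mats_def \<alpha>_def \<beta>_def)
  have det: "d * \<beta> - q * \<alpha> = P" using *(1) unfolding th by (simp add: algebra_simps)
  have Y: "\<alpha> * \<beta> < P" using *(1,9) unfolding wall_iff \<alpha>_def \<beta>_def by simp
  have "even \<alpha>" "odd \<beta>" using *(2-5) by (auto simp: \<alpha>_def \<beta>_def)
  then have parity: "\<beta> \<noteq> 0" "\<alpha> \<noteq> \<beta>" by auto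
  have qd: "q + \<alpha> < d" using *(8) th by simp
  define X Z where "X = d * \<beta>" and "Z = q * \<alpha>"
  have XZ: "X - Z = P" using det by (simp add: X_def Z_def)
  define C where "C = (2 * P + 1) * P"
  define W where "W = C * P"
  have C: "P \<le> C" "0 \<le> W" using le_mult_pos(2)[of "2 * P + 1" P] assms(1) by (auto simp: C_def W_def)
  show "0 < d" "0 < q" by fact+
  consider "\<beta> > 0" "\<alpha> < 0" | "\<beta> > 0" "\<alpha> = 0" | "\<beta> > 0" "\<alpha> > 0" "\<alpha> < \<beta>" | "\<beta> < 0" "\<alpha> \<ge> 0"
    | "\<beta> < 0" "\<alpha> < 0" "\<alpha> < \<beta>" | "\<beta> < 0" "\<alpha> < 0" "\<beta> < \<alpha>"
    using parity *(10) by linarith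
  then have "\<bar>\<alpha>\<bar> \<le> P \<and> \<bar>\<beta>\<bar> \<le> P \<and> q \<le> C \<and> d \<le> P + W"
  proof cases
    case 1
    have "d \<le> X" "\<beta> \<le> X" unfolding X_def using 1 *(7) by (intro le_mult_pos; simp)+
    moreover have "q \<le> q * (- \<alpha>)" "- \<alpha> \<le> q * (- \<alpha>)" using 1 *(6) by (intro le_mult_pos; simp)+
    then have "q \<le> - Z" "- \<alpha> \<le> - Z" by (simp_all add: Z_def)
    ultimately show ?thesis using XZ C 1 *(6,7) by simp
  next
    case 2
    have "d \<le> X" "\<beta> \<le> X" unfolding X_def using 2 *(7) by (intro le_mult_pos; simp)+
    moreover have "Z = 0" using 2 by (simp add: Z_def)
    ultimately show ?thesis using XZ C 2 qd by simp
  next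
    case 3
    have "\<alpha> \<le> \<alpha> * \<beta>" "\<beta> \<le> \<alpha> * \<beta>" using 3 by (intro le_mult_pos; simp)+
    then have ab: "\<alpha> < P" "\<beta> < P" using Y by linarith+
    have "(q + \<alpha>) * \<beta> < d * \<beta>" using qd 3 by simp
    then have "q * (\<beta> - \<alpha>) < P - \<alpha> * \<beta>" using det by (simp add: algebra_simps)
    moreover have "q \<le> q * (\<beta> - \<alpha>)" using 3 *(6) by (intro le_mult_pos) auto
    moreover have "0 < \<alpha> * \<beta>" using 3 by simp
    ultimately have q: "q < P" by linarith
    have "d \<le> X" unfolding X_def using 3 *(7) by (intro le_mult_pos) auto
    moreover have "Z \<le> W" unfolding Z_def W_def using q ab C 3 *(6) by (intro mult_mono) auto
    ultimately show ?thesis using XZ C q ab 3 by simp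
  next
    case 4
    then have "d * \<beta> < 0" "q * \<alpha> \<ge> 0" using *(6,7) by (simp_all add: mult_pos_neg)
    then show ?thesis using det assms(1) by linarith
  next
    case 5
    have "- \<alpha> \<le> (- \<alpha>) * (- \<beta>)" "- \<beta> \<le> (- \<alpha>) * (- \<beta>)" using 5 by (intro le_mult_pos; simp)+
    then have ab: "- \<alpha> < P" "- \<beta> < P" using Y by simp_all
    have "(2 * P + 1) * (- \<beta>) \<le> C" unfolding C_def using ab assms(1) by (intro mult_left_mono) auto
    then have q: "q \<le> C" using *(11) 5 by linarith
    have "d \<le> d * (- \<beta>)" using 5 *(7) by (intro le_mult_pos) auto
    then have "d \<le> - X" by (simp add: X_def)
    moreover have "q * (- \<alpha>) \<le> C * P" using q ab C 5 *(6) assms(1) by (intro mult_mono) auto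
    then have "- Z \<le> W" by (simp add: Z_def W_def)
    ultimately show ?thesis using XZ q ab 5 assms(1) by simp
  next
    case 6
    have "(q + \<alpha>) * (- \<alpha>) < d * (- \<alpha>)" using qd 6 by (intro mult_strict_right_mono) auto
    moreover have "\<alpha> * \<alpha> < \<alpha> * \<beta>" using 6 by simp
    moreover have "0 < d * (\<alpha> - \<beta>)" using 6 *(7) by simp
    ultimately have False using det Y by (simp add: algebra_simps)
    then show ?thesis ..
  qed
  then show "\<bar>t - d\<bar> \<le> P \<and> \<bar>h - q\<bar> \<le> P \<and> q \<le> (2 * P + 1) * P \<and> d \<le> P + (2 * P + 1) * P * P"
    by (simp add: C_def W_def \<alpha>_def \<beta>_def)
qed

lemma finite_trunc13:
  assumes "P > 0"
  shows "finite (trunc13 P (2 * P + 1))"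
proof (rule finite_subset)
  define B where "B = P + (2 * P + 1) * P + (2 * P + 1) * P * P"
  have "0 \<le> (2 * P + 1) * P" "0 \<le> (2 * P + 1) * P * P" using assms by auto
  then show "trunc13 P (2 * P + 1) \<subseteq> {-2*B..2*B} \<times> {-2*B..2*B} \<times> {-2*B..2*B} \<times> {-2*B..2*B}"
    using trunc13_bounds[OF assms] unfolding B_def
    by (auto simp del: mult_pos_pos) (smt (verit))+
qed simp

text \<open>\<open>wall13p\<close> is split at \<open>h = 2 * q\<close> and \<open>wall23p\<close>
  at \<open>d = 2 * t\<close>, because one part of each is paired with a \<open>wall12\<close> set
  and the other parts with each other. Equality cannot occur since \<open>h\<close> and
  \<open>d\<close> are odd.\<close>

lemma reduced_mats_pointwise:
  assumes "P > 0" and "z \<in> mats P"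
  shows "(of_bool (z \<in> reduced_mats P) :: int) - of_bool (z \<in> triangular_mats P) =
    - of_bool (z \<in> wall12p P) + of_bool (z \<in> wall12n P)
    + of_bool (z \<in> {(d, t, q, h) \<in> wall13p P. 2 * q < h}) + of_bool (z \<in> trunc13 P (2 * P + 1))
    - of_bool (z \<in> wall13n P)
    - of_bool (z \<in> {(d, t, q, h) \<in> wall23p P. 2 * t < d}) - of_bool (z \<in> trunc23 P (2 * P + 1))
    - of_bool (z \<in> cusp_mats P) + of_bool (z \<in> wall23n P)"
proof -
  obtain d t q h where z: "z = (d, t, q, h)" by (cases z)
  have m: "(d, t, q, h) \<in> mats P" using assms z by simp
  then have *: "d * h - q * t = P" "odd d" "odd t" "even q" "odd h" by (auto simp: mats_def)
  have ne: "h \<noteq> 2 * q" "d \<noteq> 2 * t" using * by auto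
  have "(of_bool ((d, t, q, h) \<in> wall13p P) :: int) = of_bool ((d, t, q, h) \<in> wall13p P \<and> 2 * q < h) +
      of_bool ((d, t, q, h) \<in> wall13p P \<and> h < 2 * q)"
    using ne by (cases "2 * q < h") auto
  moreover have "(of_bool ((d, t, q, h) \<in> wall23p P) :: int) = of_bool ((d, t, q, h) \<in> wall23p P \<and> 2 * t < d) +
      of_bool ((d, t, q, h) \<in> wall23p P \<and> d < 2 * t)"
    using ne by (cases "2 * t < d") auto
  moreover have "(of_bool ((d, t, q, h) \<in> reduced_mats P) :: int) - of_bool ((d, t, q, h) \<in> triangular_mats P) =
    - of_bool ((d, t, q, h) \<in> wall12p P) + of_bool ((d, t, q, h) \<in> wall12n P)
    + of_bool ((d, t, q, h) \<in> wall13p P) - of_bool ((d, t, q, h) \<in> wall13n P)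
    - of_bool ((d, t, q, h) \<in> wall23p P) + of_bool ((d, t, q, h) \<in> wall23n P)"
  proof -
    have "0 < d * h - q * t" using *(1) assms(1) by simp
    from reduced_crossing[OF this *(2-5)] m show ?thesis
      unfolding reduced_mats_def triangular_mats_def wall12p_def wall12n_def wall13p_def wall13n_def
        wall23p_def wall23n_def mem_Collect_eq prod.case by (simp only: simp_thms)
  qed
  ultimately show ?thesis
    using trunc13_pointwise[OF assms(1) m] unfolding z mem_Collect_eq prod.case by linarith
qed

section \<open>Summation of the wall contributions\<close>

lemma finite_triangular_mats:
  assumes "P > 0"
  shows "finite (triangular_mats P)"
proof (rule finite_subset)
  show "triangular_mats P \<subseteq> {0..P} \<times> {0..2 * P} \<times> {0} \<times> {0..P}"
  proof
    fix z assume "z \<in> triangular_mats P"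
    then obtain d t h where z: "z = (d, t, 0, h)" "d * h = P" "h > 0" "0 < t" "t < 2 * d"
      by (auto simp: triangular_mats_def mats_def)
    then have "d > 0" by linarith
    then have "d \<le> P" "h \<le> P" using le_mult_pos[of d h] z by auto
    then show "z \<in> {0..P} \<times> {0..2 * P} \<times> {0} \<times> {0..P}" using z \<open>d > 0\<close> by simp
  qed
qed simp

lemma card_split:
  assumes "finite A"
  shows "card A = card {x \<in> A. Q x} + card {x \<in> A. \<not> Q x}"
proof -
  have "card A = card ({x \<in> A. Q x} \<union> {x \<in> A. \<not> Q x})" by (rule arg_cong[where f = card]) auto
  also have "\<dots> = card {x \<in> A. Q x} + card {x \<in> A. \<not> Q x}"
    using assms by (intro card_Un_disjoint) auto
  finally show ?thesis .
qed

text \<open>The pointwise identity is summed over a finite set containing all sets involved. The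
  bijections give \<open>wall12p = B + wall23n\<close>, \<open>wall12n = C + wall13n\<close> and
  \<open>X = Y + cusp_mats\<close> for the cardinalities, so the wall terms add up to zero.\<close>

lemma card_reduced_mats_eq_triangular:
  assumes "P > 0"
  shows "finite (reduced_mats P)" "card (reduced_mats P) = card (triangular_mats P)"
proof -
  define B C where "B = {(d, t, q, h) \<in> wall13p P. 2 * q < h}" and "C = {(d, t, q, h) \<in> wall23p P. 2 * t < d}"
  define A11 A12 A21 A22 where "A11 = {(d, t, q, h) \<in> wall12p P. d * q < - t * (h + 2 * q)}"
    and "A12 = {(d, t, q, h) \<in> wall12p P. \<not> d * q < - t * (h + 2 * q)}"
    and "A21 = {(d, t, q, h) \<in> wall12n P. d * q < - t * (h + 2 * q)}"
    and "A22 = {(d, t, q, h) \<in> wall12n P. \<not> d * q < - t * (h + 2 * q)}"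
  define X X' Y where "X = trunc13 P (2 * P + 1)" and "X' = trunc13 P (2 * P - 1)" and "Y = trunc23 P (2 * P + 1)"
  have finA: "finite A11" "finite A12" "finite A21" "finite A22"
    unfolding A11_def A12_def A21_def A22_def
    by (rule finite_subset[OF _ finite_wall12(1)[of P]] finite_subset[OF _ finite_wall12(2)[of P]]; auto; fail)+
  have X'X: "X' \<subseteq> X"
  proof -
    have "(2 * P - 1) * (q - h) \<le> (2 * P + 1) * (q - h)" if "h - q < 0" for q h
      using that by (intro mult_right_mono) auto
    then have "q < (2 * P - 1) * (q - h) \<Longrightarrow> h - q < 0 \<Longrightarrow> q < (2 * P + 1) * (q - h)" for q h
      by (meson less_le_trans)
    then show ?thesis unfolding X_def X'_def trunc13_def subset_iff split_paired_All mem_Collect_eq prod.case by blast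
  qed
  have finX: "finite X" "finite X'" using finite_trunc13[OF assms] X'X finite_subset by (auto simp: X_def)
  have c: "2 * P - 1 + 2 = 2 * P + 1" by simp
  note bij = wall12p_wall13p[of P, folded A11_def B_def] wall12n_wall13n[of P, folded A22_def]
    wall12p_wall23n[of P, folded A12_def] wall12n_wall23p[of P, folded A21_def C_def]
    trunc13_trunc23[of P "2 * P - 1", unfolded c, folded X'_def Y_def]
    cusp_mats_bij[OF assms, folded X_def X'_def]
  have fin: "finite B" "finite (wall13n P)" "finite (wall23n P)" "finite C" "finite Y" "finite (cusp_mats P)"
    using bij_betw_finite[OF bij(1)] bij_betw_finite[OF bij(2)] bij_betw_finite[OF bij(3)] bij_betw_finite[OF bij(4)]
      bij_betw_finite[OF bij(5)] bij_betw_finite[OF bij(6)] finA finX by auto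
  have card: "card A11 = card B" "card A22 = card (wall13n P)" "card A12 = card (wall23n P)" "card A21 = card C"
    "card X' = card Y" "card (cusp_mats P) = card (X - X')"
    using bij by (auto dest: bij_betw_same_card)
  have "card X = card X' + card (X - X')"
    using X'X finX by (simp add: card_Diff_subset card_mono)
  moreover have "card (wall12p P) = card A11 + card A12" "card (wall12n P) = card A21 + card A22"
    unfolding A11_def A12_def A21_def A22_def
    using card_split[OF finite_wall12(1), of P "\<lambda>(d, t, q, h). d * q < - t * (h + 2 * q)"]
      card_split[OF finite_wall12(2), of P "\<lambda>(d, t, q, h). d * q < - t * (h + 2 * q)"]
    by (simp_all add: case_prod_unfold)
  ultimately have total: "- int (card (wall12p P)) + int (card (wall12n P)) + int (card B) + int (card X)
      - int (card (wall13n P)) - int (card C) - int (card Y) - int (card (cusp_mats P)) + int (card (wall23n P)) = 0"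
    using card by simp
  note pw = reduced_mats_pointwise[OF assms, folded B_def C_def X_def Y_def]
  \<comment> \<open>A reduced matrix that is not triangular makes the left side of the pointwise
    identity 1, so it lies in one of the sets counted positively on the right. This gives
    finiteness.\<close>
  have K: "reduced_mats P \<subseteq> triangular_mats P \<union> wall12n P \<union> B \<union> X \<union> wall23n P"
  proof
    fix z assume z: "z \<in> reduced_mats P"
    then have "z \<in> mats P" by (auto simp: reduced_mats_def)
    from pw[OF this] z show "z \<in> triangular_mats P \<union> wall12n P \<union> B \<union> X \<union> wall23n P"
      by (auto split: split_of_bool_asm)
  qed
  then show finK: "finite (reduced_mats P)"
    by (rule finite_subset) (use finite_wall12 fin finX finite_triangular_mats[OF assms] in simp)
  define F where "F = triangular_mats P \<union> wall12p P \<union> wall12n P \<union> B \<union> X \<union> wall13n P \<union> C \<union> Y \<union> cusp_mats P \<union> wall23n P"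
  have F: "finite F" unfolding F_def using finite_wall12 fin finX finite_triangular_mats[OF assms] by simp
  have "F \<subseteq> mats P"
    unfolding F_def B_def C_def X_def Y_def trunc13_def trunc23_def wall12p_def wall12n_def wall13p_def wall13n_def
        wall23p_def wall23n_def cusp_mats_def triangular_mats_def by auto
  then have pwF: "z \<in> F \<Longrightarrow> z \<in> mats P" for z by (rule subsetD)
  have "(\<Sum>z\<in>F. (of_bool (z \<in> reduced_mats P) :: int) - of_bool (z \<in> triangular_mats P)) =
    (\<Sum>z\<in>F. - of_bool (z \<in> wall12p P) + of_bool (z \<in> wall12n P) + of_bool (z \<in> B) + of_bool (z \<in> X)
    - of_bool (z \<in> wall13n P) - of_bool (z \<in> C) - of_bool (z \<in> Y)
    - of_bool (z \<in> cusp_mats P) + of_bool (z \<in> wall23n P))"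
    by (intro sum.cong refl pw pwF)
  moreover have cnt: "(\<Sum>z\<in>F. of_bool (z \<in> S) :: int) = int (card S)" if "S \<subseteq> F" for S
    using that F by (simp add: sum_of_bool_eq Int_absorb1)
  moreover have "reduced_mats P \<subseteq> F" using K by (auto simp: F_def)
  moreover have "triangular_mats P \<subseteq> F" "wall12p P \<subseteq> F" "wall12n P \<subseteq> F" "B \<subseteq> F" "X \<subseteq> F" "wall13n P \<subseteq> F" "C \<subseteq> F" "Y \<subseteq> F"
    "cusp_mats P \<subseteq> F" "wall23n P \<subseteq> F" by (auto simp: F_def)
  ultimately have "int (card (reduced_mats P)) - int (card (triangular_mats P)) = 0"
    using total by (simp only: sum.distrib sum_subtractf sum_negf cnt)
  then show "card (reduced_mats P) = card (triangular_mats P)" by simp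
qed

section \<open>Gauss' theorem on three triangular numbers\<close>

text \<open>For each factorization \<open>d * h = P\<close> exactly \<open>d\<close> odd numbers
  \<open>t\<close> lie between 0 and \<open>2 * d\<close>.\<close>

lemma card_triangular_mats:
  assumes "odd P" "P > 0"
  shows "int (card (triangular_mats P)) = (\<Sum>(c, e)\<in>factor_pairs P. e)"
proof -
  have "int (card (triangular_mats P)) = int (card (SIGMA z:factor_pairs P. {1..snd z}))"
  proof (rule arg_cong[where f = int], rule bij_betw_same_card, rule bij_betw_byWitness)
    let ?f = "\<lambda>(d, t, q, h). ((h, d), (t + 1) div 2) :: (int \<times> int) \<times> int"
    let ?g = "\<lambda>((h, d), k). (d, 2 * k - 1, 0, h) :: int \<times> int \<times> int \<times> int"
    show "\<forall>z\<in>triangular_mats P. ?g (?f z) = z"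
      by (auto simp: triangular_mats_def mats_def add.commute[of 1] odd_two_times_div_two_succ)
    show "\<forall>z\<in>(SIGMA z:factor_pairs P. {1..snd z}). ?f (?g z) = z" by auto
    show "?f ` triangular_mats P \<subseteq> (SIGMA z:factor_pairs P. {1..snd z})"
      by (auto simp: triangular_mats_def mats_def factor_pairs_def mult.commute)
    show "?g ` (SIGMA z:factor_pairs P. {1..snd z}) \<subseteq> triangular_mats P"
      using assms by (auto simp: triangular_mats_def mats_def factor_pairs_def mult.commute)
  qed
  also have "\<dots> = (\<Sum>z\<in>factor_pairs P. int (card {1..snd z}))"
    by (subst card_SigmaI) (auto simp: finite_factor_pairs)
  also have "\<dots> = (\<Sum>(c, e)\<in>factor_pairs P. e)"
    by (rule sum.cong) (auto simp: factor_pairs_def)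
  finally show ?thesis .
qed

text \<open>The triple stands for the form \<open>d x^2 + f x y + e y^2\<close> of discriminant
  \<open>- M\<close>. The bounds say that \<open>f\<close>, \<open>2 * d - f\<close> and
  \<open>2 * e - f\<close> are positive, which is weaker than Gauss reduction.\<close>

definition reduced_forms :: "int \<Rightarrow> (int \<times> int \<times> int) set" where
  "reduced_forms M = {(d, e, f). odd d \<and> odd e \<and> odd f \<and> 0 < f \<and> f < 2 * d \<and> f < 2 * e \<and> 4 * d * e - f\<^sup>2 = M}"

lemma finite_reduced_forms: "finite (reduced_forms M)"
proof (rule finite_subset)
  show "reduced_forms M \<subseteq> {0..M} \<times> {0..M} \<times> {0..M}"
  proof
    fix z assume "z \<in> reduced_forms M"
    then obtain d e f where z: "z = (d, e, f)" and *: "0 < f" "f < 2 * d" "f < 2 * e" "4 * d * e - f\<^sup>2 = M"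
      by (auto simp: reduced_forms_def)
    define u v where "u = 2 * d - f" and "v = 2 * e - f"
    have uv: "u > 0" "v > 0" using * by (auto simp: u_def v_def)
    have "M = u * v + f * u + f * v"
      unfolding u_def v_def *(4)[symmetric] by (simp add: power2_eq_square algebra_simps)
    moreover have "u \<le> u * v" "v \<le> u * v" "f \<le> f * u" "f \<le> f * v" using uv * by (intro le_mult_pos; simp)+
    ultimately have "f \<le> M" "2 * d \<le> 2 * M" "2 * e \<le> 2 * M" using uv * unfolding u_def v_def by linarith+
    then show "z \<in> {0..M} \<times> {0..M} \<times> {0..M}" using z * by simp
  qed
qed simp

text \<open>A matrix is determined by \<open>f = q + t\<close> and
  \<open>\<bar>t - q\<bar> = 2 * x + 1\<close>, since \<open>q\<close> is the even one of the two
  entries. Moreover \<open>4 * d * h - (q + t)^2 = 4 * (2 * n + 1) - (2 * x + 1)^2 = 8 * (n -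
  triangle x) + 3\<close>.\<close>

lemma card_reduced_mats:
  "card (reduced_mats (2 * int n + 1)) = (\<Sum>x | triangle x \<le> n. card (reduced_forms (8 * int (n - triangle x) + 3)))"
proof -
  let ?S = "SIGMA x:{x. triangle x \<le> n}. reduced_forms (8 * int (n - triangle x) + 3)"
  let ?f = "\<lambda>(d, t, q, h). (nat ((\<bar>t - q\<bar> - 1) div 2), (d, h, q + t)) :: nat \<times> (int \<times> int \<times> int)"
  let ?g = "\<lambda>(x, (d, e, f)). if even ((f - (2 * int x + 1)) div 2)
      then (d, (f + (2 * int x + 1)) div 2, (f - (2 * int x + 1)) div 2, e)
      else (d, (f - (2 * int x + 1)) div 2, (f + (2 * int x + 1)) div 2, e)"
  have S: "?f (d, t, q, h) \<in> ?S \<and> ?g (?f (d, t, q, h)) = (d, t, q, h)"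
    if "(d, t, q, h) \<in> reduced_mats (2 * int n + 1)" for d t q h
  proof -
    have *: "d * h - q * t = 2 * int n + 1" "odd d" "odd t" "even q" "odd h" "0 < q + t" "q + t < 2 * d" "q + t < 2 * h"
      using that by (auto simp: reduced_mats_def mats_def)
    have "odd \<bar>t - q\<bar>" using * by simp
    then obtain k where k: "\<bar>t - q\<bar> = 2 * k + 1" by (rule oddE)
    then have "k \<ge> 0" by linarith
    then obtain x where "k = int x" using zero_le_imp_eq_int by blast
    with k have x: "\<bar>t - q\<bar> = 2 * int x + 1" by simp
    have "0 \<le> q + t" using * by simp
    then have "(q + t) * (q + t) < (2 * d) * (2 * h)" using * by (intro mult_strict_mono) auto
    moreover have forms: "4 * d * h - (q + t)\<^sup>2 = 4 * (2 * int n + 1) - \<bar>t - q\<bar>\<^sup>2"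
      unfolding *(1)[symmetric] by (simp add: power2_eq_square algebra_simps)
    ultimately have "0 < 4 * (2 * int n + 1) - (2 * int x + 1)\<^sup>2"
      unfolding x by (simp add: power2_eq_square)
    then have le: "triangle x \<le> n" unfolding eight_triangle[symmetric] by presburger
    have "4 * d * h - (q + t)\<^sup>2 = 8 * int (n - triangle x) + 3"
      using forms le unfolding x eight_triangle[symmetric] by (simp add: of_nat_diff)
    then have "(x, (d, h, q + t)) \<in> ?S" using le * by (simp add: reduced_forms_def)
    moreover have "nat ((\<bar>t - q\<bar> - 1) div 2) = x" unfolding x by simp
    moreover have "?g (x, (d, h, q + t)) = (d, t, q, h)"
    proof (cases "t - q \<ge> 0")
      case True
      then have "2 * int x + 1 = t - q" using x by simp
      then show ?thesis using * by simp
    next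
      case False
      then have "2 * int x + 1 = q - t" using x by simp
      then show ?thesis using * by simp
    qed
    ultimately show ?thesis using le by simp
  qed
  have T: "?g (x, (d, e, f)) \<in> reduced_mats (2 * int n + 1) \<and> ?f (?g (x, (d, e, f))) = (x, (d, e, f))"
    if "(x, (d, e, f)) \<in> ?S" for x d e f
  proof -
    have *: "triangle x \<le> n" "odd d" "odd e" "odd f" "0 < f" "f < 2 * d" "f < 2 * e"
      "4 * d * e - f\<^sup>2 = 8 * int (n - triangle x) + 3"
      using that by (auto simp: reduced_forms_def)
    define u v where "u = (f - (2 * int x + 1)) div 2" and "v = (f + (2 * int x + 1)) div 2"
    have uv: "f = u + v" "2 * int x + 1 = v - u" using \<open>odd f\<close> unfolding u_def v_def by presburger+
    have "4 * (d * e - u * v) = 4 * d * e - f\<^sup>2 + (2 * int x + 1)\<^sup>2"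
      unfolding uv by (simp add: power2_eq_square algebra_simps)
    also have "\<dots> = 4 * (2 * int n + 1)"
      using * unfolding eight_triangle[symmetric] by (simp add: of_nat_diff)
    finally have det: "d * e - u * v = 2 * int n + 1" by simp
    have "odd (u + v)" using * uv by simp
    have x: "nat ((\<bar>v - u\<bar> - 1) div 2) = x" "nat ((\<bar>u - v\<bar> - 1) div 2) = x"
      using uv(2) by (simp_all add: abs_minus_commute[of u] flip: uv(2))
    have g: "?g (x, (d, e, f)) = (if even u then (d, v, u, e) else (d, u, v, e))"
      unfolding u_def v_def prod.case ..
    have mem: "(d, v, u, e) \<in> reduced_mats (2 * int n + 1)" if "even u"
      using that det * \<open>odd (u + v)\<close> uv(1) by (simp add: reduced_mats_def mats_def)
    have mem': "(d, u, v, e) \<in> reduced_mats (2 * int n + 1)" if "odd u"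
      using that det * \<open>odd (u + v)\<close> uv(1) by (simp add: reduced_mats_def mats_def mult.commute add.commute)
    show ?thesis
    proof (cases "even u")
      case True
      then show ?thesis unfolding g using mem x uv(1) by simp
    next
      case False
      then show ?thesis unfolding g using mem' x uv(1) by simp
    qed
  qed
  have S': "?f z \<in> ?S \<and> ?g (?f z) = z" if "z \<in> reduced_mats (2 * int n + 1)" for z
    using S[of "fst z" "fst (snd z)" "fst (snd (snd z))" "snd (snd (snd z))"] that
    by (simp only: prod.collapse)
  have T': "?g z \<in> reduced_mats (2 * int n + 1) \<and> ?f (?g z) = z" if "z \<in> ?S" for z
    using T[of "fst z" "fst (snd z)" "fst (snd (snd z))" "snd (snd (snd z))"] that
    by (simp only: prod.collapse)
  have "bij_betw ?f (reduced_mats (2 * int n + 1)) ?S"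
    by (rule bij_betw_byWitness[of _ ?g]) (use S' T' in blast)+
  then have "card (reduced_mats (2 * int n + 1)) = card ?S" by (rule bij_betw_same_card)
  also have "\<dots> = (\<Sum>x | triangle x \<le> n. card (reduced_forms (8 * int (n - triangle x) + 3)))"
    using finite_triangle_le finite_reduced_forms by (intro card_SigmaI) auto
  finally show ?thesis .
qed

definition reduced_form_series :: "int fps" where
  "reduced_form_series = Abs_fps (\<lambda>n. int (card (reduced_forms (8 * int n + 3))))"

lemma triangle_series_nonzero: "triangle_series \<noteq> 0"
proof -
  have "0 \<in> range triangle" by (metis rangeI triangle_0)
  then have "fps_nth triangle_series 0 = 1" by (simp add: triangle_series_def)
  then show ?thesis by auto
qed

lemma triangle_series_power3: "triangle_series ^ 3 = reduced_form_series"
proof -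
  have "triangle_series * reduced_form_series = odd_divisor_series"
  proof (rule fps_ext)
    fix n
    have "fps_nth (triangle_series * reduced_form_series) n = int (card (reduced_mats (2 * int n + 1)))"
      by (simp add: fps_nth_triangle_series_mult card_reduced_mats reduced_form_series_def)
    also have "\<dots> = (\<Sum>(c, e)\<in>factor_pairs (2 * int n + 1). e)"
      by (simp add: card_reduced_mats_eq_triangular card_triangular_mats)
    finally show "fps_nth (triangle_series * reduced_form_series) n = fps_nth odd_divisor_series n"
      by (simp add: odd_divisor_series_def)
  qed
  also have "\<dots> = triangle_series * triangle_series ^ 3"
    unfolding triangle_series_power4[symmetric] by (simp add: eval_nat_numeral)
  finally show ?thesis using triangle_series_nonzero by simp
qed

lemma three_triangular: "\<exists>x y z. n = triangle x + triangle y + triangle z"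
proof -
  \<comment> \<open>The principal form \<open>x^2 + x y + (2 * n + 1) y^2\<close> has discriminant
    \<open>- (8 * n + 3)\<close> and is always reduced, so the coefficient of the cube is
    positive.\<close>
  have "(1, 2 * int n + 1, 1) \<in> reduced_forms (8 * int n + 3)"
    by (simp add: reduced_forms_def)
  then have "card (reduced_forms (8 * int n + 3)) > 0"
    using finite_reduced_forms card_gt_0_iff by blast
  then have "fps_nth (triangle_series * (triangle_series * triangle_series)) n \<noteq> 0"
    using triangle_series_power3 by (simp add: eval_nat_numeral reduced_form_series_def fps_eq_iff)
  then obtain x where x: "triangle x \<le> n" "fps_nth (triangle_series * triangle_series) (n - triangle x) \<noteq> 0"
    unfolding fps_nth_triangle_series_mult[of "triangle_series * triangle_series"]
    by (metis (mono_tags, lifting) mem_Collect_eq sum.neutral)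
  then obtain y where y: "triangle y \<le> n - triangle x" "fps_nth triangle_series (n - triangle x - triangle y) \<noteq> 0"
    unfolding fps_nth_triangle_series_mult
    by (metis (mono_tags, lifting) mem_Collect_eq sum.neutral)
  then obtain z where "n - triangle x - triangle y = triangle z"
    by (auto simp: triangle_series_def split: if_splits)
  then have "n = triangle x + triangle y + triangle z" using x y by linarith
  then show ?thesis by blast
qed

lemma odd_int_triangle:
  assumes "odd (s :: int)"
  obtains x where "s\<^sup>2 = 8 * int (triangle x) + 1"
proof -
  obtain k where k: "s = 2 * k + 1" using assms by (rule oddE)
  define x where "x = (if k \<ge> 0 then nat k else nat (- k - 1))"
  have "(2 * int x + 1)\<^sup>2 = s\<^sup>2" unfolding x_def k by (auto simp: power2_eq_square algebra_simps)
  then show ?thesis using that[of x] eight_triangle[of x] by simp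
qed

section \<open>The forms of the theorem\<close>

lemma sign_mod_3:
  fixes X :: int
  obtains X' where "X'\<^sup>2 = X\<^sup>2" "X' mod 3 = 0 \<or> X' mod 3 = 1"
proof -
  have "X mod 3 = 0 \<or> X mod 3 = 1 \<or> (- X) mod 3 = 1" by presburger
  then show ?thesis using that[of X] that[of "- X"] by auto
qed

text \<open>Three residues from 0 and 1 add up to a multiple of 3 only if all are equal. It is
  applied with the squares as \<open>u\<close>, \<open>v\<close>, \<open>w\<close>.\<close>

lemma mod_3_eq_of_sum:
  fixes a b c u v w :: int
  assumes "(u + v + w) mod 3 = 0" "u mod 3 = a mod 3" "v mod 3 = b mod 3" "w mod 3 = c mod 3"
      "a mod 3 = 0 \<or> a mod 3 = 1" "b mod 3 = 0 \<or> b mod 3 = 1" "c mod 3 = 0 \<or> c mod 3 = 1"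
  shows "a mod 3 = b mod 3 \<and> b mod 3 = c mod 3"
proof -
  have "((u mod 3 + v mod 3) mod 3 + w mod 3) mod 3 = 0"
    using assms(1) by (simp only: mod_add_eq mod_add_left_eq mod_add_right_eq)
  then show ?thesis using assms(2-) by (elim disjE) simp_all
qed
lemma triangular_plus_loeschian:
  "\<exists>x y z. int m = int (triangle x) + (y\<^sup>2 + y * z + z\<^sup>2)"
proof -
  obtain x y z where "3 * m = triangle x + triangle y + triangle z" using three_triangular by blast
  then have "24 * int m + 3 = (2 * int x + 1)\<^sup>2 + (2 * int y + 1)\<^sup>2 + (2 * int z + 1)\<^sup>2"
    unfolding eight_triangle[symmetric] by simp
  moreover obtain X where X: "X\<^sup>2 = (2 * int x + 1)\<^sup>2" "X mod 3 = 0 \<or> X mod 3 = 1" by (rule sign_mod_3)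
  moreover obtain Y where Y: "Y\<^sup>2 = (2 * int y + 1)\<^sup>2" "Y mod 3 = 0 \<or> Y mod 3 = 1" by (rule sign_mod_3)
  moreover obtain Z where Z: "Z\<^sup>2 = (2 * int z + 1)\<^sup>2" "Z mod 3 = 0 \<or> Z mod 3 = 1" by (rule sign_mod_3)
  ultimately have sum: "24 * int m + 3 = X\<^sup>2 + Y\<^sup>2 + Z\<^sup>2" by simp
  have "odd (X\<^sup>2)" "odd (Y\<^sup>2)" "odd (Z\<^sup>2)" unfolding X(1) Y(1) Z(1) by simp_all
  then have odd: "odd X" "odd Y" "odd Z" by simp_all
  have sum0: "(X\<^sup>2 + Y\<^sup>2 + Z\<^sup>2) mod 3 = 0" unfolding sum[symmetric] by presburger
  have square_mod_3: "A\<^sup>2 mod 3 = A mod 3" if "A mod 3 = 0 \<or> A mod 3 = 1" for A :: int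
    by (subst power_mod[symmetric]) (use that in auto)
  have XYZ: "X mod 3 = Y mod 3 \<and> Y mod 3 = Z mod 3"
    by (rule mod_3_eq_of_sum[OF sum0 square_mod_3[OF X(2)] square_mod_3[OF Y(2)] square_mod_3[OF Z(2)] X(2) Y(2) Z(2)])
  have dvd6: "6 dvd a - b" if "a mod 3 = b mod 3" "odd a" "odd b" for a b :: int
    using that by presburger
  have "6 dvd X - Y" "6 dvd Y - Z"
    using dvd6[OF conjunct1[OF XYZ] odd(1,2)] dvd6[OF conjunct2[OF XYZ] odd(2,3)] .
  then obtain p q where "X - Y = 6 * p" "Y - Z = 6 * q" by (auto elim!: dvdE)
  then have pq: "X = Y + 6 * p" "Z = Y - 6 * q" by simp_all
  \<comment> \<open>\<open>s\<close> is the mean of \<open>X\<close>, \<open>Y\<close>,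
    \<open>Z\<close>. The sum of squares is three times the square of the mean plus the squared
    deviations, which here make up \<open>24 * (p^2 + p * q + q^2)\<close>.\<close>
  define s where "s = Y + 2 * p - 2 * q"
  have "3 * (8 * int m + 1) = 3 * (s\<^sup>2 + 8 * (p\<^sup>2 + p * q + q\<^sup>2))"
    using sum unfolding pq s_def by (simp add: power2_eq_square algebra_simps)
  moreover have "odd s" using odd by (simp add: s_def)
  then obtain w where "s\<^sup>2 = 8 * int (triangle w) + 1" by (rule odd_int_triangle)
  ultimately have "int m = int (triangle w) + (p\<^sup>2 + p * q + q\<^sup>2)" by simp
  then show ?thesis by blast
qed

section \<open>Necessity: the values 1, 2, 4 and 8\<close>

lemma loeschian_residues:
  fixes y z :: int
  shows "(y\<^sup>2 + y * z + z\<^sup>2) mod 3 \<noteq> 2" "even (y\<^sup>2 + y * z + z\<^sup>2) \<Longrightarrow> 4 dvd y\<^sup>2 + y * z + z\<^sup>2" "y\<^sup>2 + y * z + z\<^sup>2 \<ge> 0"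
proof -
  have "y\<^sup>2 + y * z + z\<^sup>2 = (y - z)\<^sup>2 + 3 * (y * z)" by (simp add: power2_eq_square algebra_simps)
  then have "(y\<^sup>2 + y * z + z\<^sup>2) mod 3 = (y - z)\<^sup>2 mod 3" by (simp only: mod_mult_self2)
  also have "\<dots> = ((y - z) mod 3)\<^sup>2 mod 3" by (simp add: power_mod)
  also have "(y - z) mod 3 = 0 \<or> (y - z) mod 3 = 1 \<or> (y - z) mod 3 = 2" by presburger
  then have "((y - z) mod 3)\<^sup>2 mod 3 \<noteq> 2" by auto
  finally show "(y\<^sup>2 + y * z + z\<^sup>2) mod 3 \<noteq> 2" .
  show "4 dvd y\<^sup>2 + y * z + z\<^sup>2" if "even (y\<^sup>2 + y * z + z\<^sup>2)"
  proof -
    have "even y" "even z" using that by auto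
    then show ?thesis by (auto elim!: evenE simp: power2_eq_square)
  qed
  have "4 * (y\<^sup>2 + y * z + z\<^sup>2) = (2 * y + z)\<^sup>2 + 3 * z\<^sup>2" by (simp add: power2_eq_square algebra_simps)
  also have "\<dots> \<ge> 0" by simp
  finally show "y\<^sup>2 + y * z + z\<^sup>2 \<ge> 0" by simp
qed

lemma triangle_cases: "triangle x \<in> {0, 1, 3, 6} \<or> triangle x \<ge> 10"
proof -
  have "strict_mono triangle" by (simp add: strict_mono_Suc_iff)
  then have "triangle 4 \<le> triangle x" if "x \<ge> 4" using that by (simp add: strict_mono_less_eq)
  moreover have "triangle 4 = 10" "triangle 1 = 1" "triangle 2 = 3" "triangle 3 = 6" by (simp_all add: triangle_def)
  moreover have "x = 0 \<or> x = 1 \<or> x = 2 \<or> x = 3 \<or> x \<ge> 4" by linarith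
  ultimately show ?thesis by auto
qed

text \<open>The value 1 forces \<open>a = 1\<close> or \<open>c = 1\<close>. As 2 is not of the form
  \<open>y^2 + y * z + z^2\<close> and not triangular, the value 2 leaves the pairs (1,1), (2,1) and
  (1,2); then 8 excludes (2,1) and 4 excludes (1,2).\<close>

lemma represents_1248:
  fixes a c :: int
  assumes "a > 0" "c > 0" and rep: "\<forall>n\<in>{1, 2, 4, 8}. form_represents (g_form a c) n"
  shows "a = 1" "c = 1"
proof -
  define good where "good N \<longleftrightarrow> N \<ge> 0 \<and> N mod 3 \<noteq> 2 \<and> (even N \<longrightarrow> 4 dvd N)" for N :: int
  have rep': "\<exists>t N. good N \<and> (t = 0 \<or> t = 1 \<or> t = 3 \<or> t = 6 \<or> t \<ge> 10) \<and> int n = a * t + c * N"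
    if "n \<in> {1, 2, 4, 8}" for n
  proof -
    from rep that obtain x y z where n: "int n = a * int (triangle x) + c * (y\<^sup>2 + y * z + z\<^sup>2)"
      by (auto simp: form_represents_def g_form_def)
    have "good (y\<^sup>2 + y * z + z\<^sup>2)" using loeschian_residues[of y z] by (simp add: good_def)
    moreover have "int (triangle x) = 0 \<or> int (triangle x) = 1 \<or> int (triangle x) = 3 \<or> int (triangle x) = 6
        \<or> int (triangle x) \<ge> 10"
      using triangle_cases[of x] by auto
    ultimately show ?thesis using n by blast
  qed
  have le: "t \<le> n \<and> N \<le> n" if "n = a * t + c * N" "t = 0 \<or> t = 1 \<or> t = 3 \<or> t = 6 \<or> t \<ge> 10" "good N" for t N n
  proof -
    have "t \<ge> 0" using that(2) by auto
    moreover have "N \<ge> 0" using that(3) by (simp add: good_def)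
    moreover have "1 * t \<le> a * t" "1 * N \<le> c * N" using assms calculation by (intro mult_right_mono; simp)+
    ultimately show ?thesis using that(1) by simp
  qed
  obtain t1 N1 where 1: "good N1" "t1 = 0 \<or> t1 = 1 \<or> t1 = 3 \<or> t1 = 6 \<or> t1 \<ge> 10" "1 = a * t1 + c * N1"
    using rep'[of 1] by auto
  obtain t2 N2 where 2: "good N2" "t2 = 0 \<or> t2 = 1 \<or> t2 = 3 \<or> t2 = 6 \<or> t2 \<ge> 10" "2 = a * t2 + c * N2"
    using rep'[of 2] by auto
  obtain t4 N4 where 4: "good N4" "t4 = 0 \<or> t4 = 1 \<or> t4 = 3 \<or> t4 = 6 \<or> t4 \<ge> 10" "4 = a * t4 + c * N4"
    using rep'[of 4] by auto
  obtain t8 N8 where 8: "good N8" "t8 = 0 \<or> t8 = 1 \<or> t8 = 3 \<or> t8 = 6 \<or> t8 \<ge> 10" "8 = a * t8 + c * N8"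
    using rep'[of 8] by auto
  have "t2 \<le> 2" "N2 \<le> 2" "t1 \<le> 1" "N1 \<le> 1" using le[OF 1(3,2,1)] le[OF 2(3,2,1)] by simp_all
  have "N2 \<noteq> 2" using 2(1) by (auto simp: good_def)
  have t2: "t2 = 0 \<or> t2 = 1" using 2(2) \<open>t2 \<le> 2\<close> by linarith
  have N2: "N2 = 0 \<or> N2 = 1" using 2(1) \<open>N2 \<le> 2\<close> \<open>N2 \<noteq> 2\<close> by (auto simp: good_def)
  have "a = 1 \<or> c = 1"
  proof -
    have "t1 = 0 \<or> t1 = 1" using 1(2) \<open>t1 \<le> 1\<close> by linarith
    moreover have "N1 = 0 \<or> N1 = 1" using 1(1) \<open>N1 \<le> 1\<close> by (auto simp: good_def)
    ultimately show ?thesis using 1(3) assms(1,2) by auto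
  qed
  moreover have "(a = 2 \<and> t2 = 1 \<and> N2 = 0) \<or> (c = 2 \<and> t2 = 0 \<and> N2 = 1) \<or> (a + c = 2)"
    using t2 N2 2(3) by auto
  ultimately consider "a = 2" "c = 1" | "a = 1" "c = 2" | "a = 1" "c = 1" using assms(1,2) by force
  then have "a = 1 \<and> c = 1"
  proof cases
    case 1
    then have "8 = 2 * t8 + N8" using 8 by simp
    \<comment> \<open>For \<open>t8\<close> equal to 0, 1, 3 the number \<open>N8\<close> would be
      8, 6, 2: the first and last are 2 modulo 3, and 6 is even but not divisible by 4. Larger
      \<open>t8\<close> make \<open>N8\<close> negative.\<close>
    then show ?thesis using 8(1,2) unfolding good_def by presburger
  next
    case 2
    then have "4 = t4 + 2 * N4" using 4 by simp
    moreover have "N4 \<ge> 0" using 4(1) by (simp add: good_def)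
    \<comment> \<open>\<open>t4\<close> must be even and at most 4, hence 0; but 2 is excluded
      modulo 3.\<close>
    ultimately have "N4 = 2" using 4(2) by presburger
    then show ?thesis using 4(1) by (simp add: good_def)
  qed simp
  then show "a = 1" "c = 1" by auto
qed

theorem theorem1p3:
  fixes a c :: int
  assumes "a > 0" and "c > 0"
  shows "((\<forall>n::nat. form_represents (g_form a c) n) \<longleftrightarrow> (a, c) = (1, 1)) \<and>
    ((\<forall>n \<in> {1, 2, 4, 8}. form_represents (g_form a c) n) \<longrightarrow>
      (\<forall>n::nat. form_represents (g_form a c) n))"
proof -
  have "form_represents (g_form 1 1) n" for n
    using triangular_plus_loeschian[of n] by (simp add: form_represents_def g_form_def)
  then show ?thesis using represents_1248[OF assms] by auto
qed

end
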